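(* (a) The set of all admissible elements $e_\alpha$ with admissible sequences $\alpha$ ending at $1$ coincides with the set of elements $$e_1a^{32}_ra^{24}_sa^{34}_t,\qquad r,s,t=0,1,2,\dots$$ Similarly, the set of all admissible elements $e_\alpha$ with admissible sequences $\alpha$ ending at $i\in\{2,3,4\}$ coincides with the set of elements $$e_ia^{jl}_ra^{lk}_sa^{kj}_t,\qquad r,s,t=0,1,2,\dots,\quad\{i,j,k,l\}=\{1,2,3,4\}.$$ (b) The set of all admissible elements $f_{\alpha0}$ with admissible sequences $\alpha$ ending at $1$ coincides with the set of elements $$e_\alpha(e_1a^{34}_{t+1}+a^{42}_{s+1}a^{32}_{r-1})=e_1a^{34}_ta^{42}_sa^{32}_r\,(e_1a^{34}_{t+1}+a^{42}_{s+1}a^{32}_{r-1}),\qquad r,s,t=0,1,2,\dots$$ Similarly, the set of all admissible elements $f_{\alpha0}$ with admissible sequences $\alpha$ ending at $i\in\{2,3,4\}$ coincides with the set of elements $$e_\alpha(e_ia^{jk}_{t+1}+a^{kl}_{s+1}a^{jl}_{r-1})=e_ia^{jk}_ta^{kl}_sa^{lj}_r\,(e_ia^{jk}_{t+1}+a^{kl}_{s+1}a^{jl}_{r-1}),\qquad r,s,t=0,1,2,\dots,\quad\{i,j,k,l\}=\{1,2,3,4\}.$$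
   Context: **Lattice.** $D^4$ is the free modular lattice generated by $e_1,e_2,e_3,e_4$, with greatest element $I$. Join is written $+$, meet is written as juxtaposition. **Atomic elements.** For $\{i,j,k,l\}=\{1,2,3,4\}$: $a^{ij}_0=I$ and $a^{ij}_n=e_i+e_ja^{kl}_{n-1}$ for $n\ge1$ (here $e_ja^{kl}_{n-1}=e_ja^{lk}_{n-1}$). It is understood that lower indices of atomic elements have to be non-negative. **Admissible sequences.** An admissible sequence is a finite sequence $\alpha=i_n\dots i_1$ with entries in $\{1,2,3,4\}$ and $i_p\ne i_{p+1}$, where consecutive entries $ijl$ may be replaced by $ikl$ for $\{i,j,k,l\}=\{1,2,3,4\}$ (the two sequences are identified). $i_1$ is the start, $i_n$ is the end. $(pq)^t$ denotes $pq$ repeated $t$ times. **Admissible elements.** For an admissible sequence $\alpha$ starting at $1$, which is of one of the following types, $e_\alpha$ and $f_{\alpha0}$ are defined as follows (the different expressions given for one element are equal; every lower index has to be non-negative): - $(21)^t(41)^r(31)^s$: $e_\alpha=e_2a^{31}_{2s}a^{41}_{2r}a^{34}_{2t-1}$, $f_{\alpha0}=e_\alpha(e_2a^{34}_{2t}+a^{41}_{2r+1}a^{31}_{2s-1})=e_\alpha(a^{43}_{2t}+e_1a^{24}_{2r}a^{23}_{2s})$; - $(31)^s(41)^r(21)^t$: $e_\alpha=e_3a^{21}_{2t}a^{41}_{2r}a^{24}_{2s-1}$, $f_{\alpha0}=e_\alpha(e_3a^{42}_{2s}+a^{41}_{2r+1}a^{21}_{2t-1})=e_\alpha(a^{42}_{2s}+e_1a^{34}_{2r}a^{32}_{2t})$;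 - $(41)^r(31)^s(21)^t$: $e_\alpha=e_4a^{21}_{2t}a^{31}_{2s}a^{32}_{2r-1}$, $f_{\alpha0}=e_\alpha(e_4a^{32}_{2r}+a^{31}_{2s+1}a^{21}_{2t-1})=e_\alpha(a^{32}_{2r}+e_1a^{43}_{2s}a^{42}_{2t})$; - $1(41)^r(31)^s(21)^t$: $e_\alpha=e_1a^{24}_{2s}a^{34}_{2t}a^{32}_{2r}$, $f_{\alpha0}=e_\alpha(e_1a^{32}_{2r+1}+a^{24}_{2s+1}a^{34}_{2t-1})=e_\alpha(a^{32}_{2r+1}+e_4a^{21}_{2s}a^{31}_{2t})$; - $2(41)^r(31)^s(21)^t$: $e_\alpha=e_2a^{34}_{2t}a^{31}_{2s+1}a^{14}_{2r-1}=e_2a^{34}_{2t}a^{31}_{2s-1}a^{14}_{2r+1}$, $f_{\alpha0}=e_\alpha(e_2a^{14}_{2r}+a^{31}_{2s+2}a^{34}_{2t-1})=e_\alpha(a^{14}_{2r}+e_3a^{21}_{2s+1}a^{24}_{2t})$; - $3(41)^r(21)^t(31)^s$: $e_\alpha=e_3a^{24}_{2s}a^{21}_{2t+1}a^{14}_{2r-1}=e_3a^{24}_{2s}a^{21}_{2t-1}a^{14}_{2r+1}$, $f_{\alpha0}=e_\alpha(e_3a^{14}_{2r}+a^{21}_{2t+2}a^{24}_{2s-1})=e_\alpha(a^{14}_{2r}+e_2a^{31}_{2t+1}a^{34}_{2s})$; - $4(21)^t(31)^s(41)^r$: $e_\alpha=e_4a^{32}_{2r}a^{31}_{2s+1}a^{12}_{2t-1}=e_4a^{32}_{2r}a^{31}_{2s-1}a^{12}_{2t+1}$,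 $f_{\alpha0}=e_\alpha(e_4a^{12}_{2t}+a^{31}_{2s}a^{32}_{2r+1})=e_\alpha(a^{12}_{2t}+e_3a^{41}_{2s+1}a^{42}_{2r})$; - $(14)^r(31)^s(21)^t$: $e_\alpha=e_1a^{23}_{2r+1}a^{24}_{2s-1}a^{34}_{2t-1}=e_1a^{23}_{2r-1}a^{24}_{2s-1}a^{34}_{2t+1}=e_1a^{23}_{2r-1}a^{24}_{2s+1}a^{34}_{2t-1}$, $f_{\alpha0}=e_\alpha(e_1a^{23}_{2r}+a^{24}_{2s}a^{34}_{2t})=e_\alpha(e_1a^{24}_{2s}+a^{34}_{2t}a^{23}_{2r})=e_\alpha(e_1a^{34}_{2t}+a^{23}_{2r}a^{24}_{2s})$. For sequences starting at $m\ne1$, permute the indices accordingly (interchange $1$ and $m$ everywhere). In (b), $e_\alpha$ stands for the admissible element written out on the right-hand side of the displayed equality.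
   Formalization: In (b), for r=0 (a_{r-1} undefined) another positive index is lowered instead; r=s=t=0 gives e_i(e_j+e_k+e_l). The listed expressions for e_α, f_α0 are not all equal, so one is fixed per type; for 2(41)^r(31)^s (t=0) and 3(41)^r(21)^t (s=0), f_α0 has the permuted form of the type ending at 4. *)

theory Defs
  imports Main
begin

unbundle lattice_syntax

section \<open>The free modular lattice on four generators\<close>

class modular_lattice = lattice +
  assumes modular: "x \<le> z \<Longrightarrow> x \<squnion> (y \<sqinter> z) = (x \<squnion> y) \<sqinter> z"

text \<open>The index set \<open>{1,2,3,4}\<close>.\<close>

datatype idx = n1 | n2 | n3 | n4

lemma UNIV_idx: "(UNIV :: idx set) = {n1, n2, n3, n4}"
  using idx.exhaust by auto

datatype mterm = Gen idx | Join mterm mterm | Meet mterm mterm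

text \<open>Provable equality of lattice terms in the equational theory of modular lattices.\<close>

inductive meq :: "mterm \<Rightarrow> mterm \<Rightarrow> bool" (infix "\<doteq>" 50) where
  refl: "s \<doteq> s"
| sym: "s \<doteq> t \<Longrightarrow> t \<doteq> s"
| trans: "s \<doteq> t \<Longrightarrow> t \<doteq> u \<Longrightarrow> s \<doteq> u"
| cong_Join: "s \<doteq> s' \<Longrightarrow> t \<doteq> t' \<Longrightarrow> Join s t \<doteq> Join s' t'"
| cong_Meet: "s \<doteq> s' \<Longrightarrow> t \<doteq> t' \<Longrightarrow> Meet s t \<doteq> Meet s' t'"
| comm_Join: "Join s t \<doteq> Join t s"
| comm_Meet: "Meet s t \<doteq> Meet t s"
| assoc_Join: "Join (Join s t) u \<doteq> Join s (Join t u)"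
| assoc_Meet: "Meet (Meet s t) u \<doteq> Meet s (Meet t u)"
| absorb_Join: "Join s (Meet s t) \<doteq> s"
| absorb_Meet: "Meet s (Join s t) \<doteq> s"
| modular: "Join (Meet s u) (Meet t u) \<doteq> Meet (Join (Meet s u) t) u"

quotient_type D4 = mterm / meq
  by (intro equivpI reflpI sympI transpI) (blast intro: meq.intros)+

lift_definition e :: "idx \<Rightarrow> D4" is Gen .

instantiation D4 :: "{inf, sup}"
begin

lift_definition sup_D4 :: "D4 \<Rightarrow> D4 \<Rightarrow> D4" is Join by (rule meq.cong_Join)
lift_definition inf_D4 :: "D4 \<Rightarrow> D4 \<Rightarrow> D4" is Meet by (rule meq.cong_Meet)

instance ..

end

instantiation D4 :: ord
begin

definition less_eq_D4 :: "D4 \<Rightarrow> D4 \<Rightarrow> bool" where "x \<le> y \<longleftrightarrow> x \<sqinter> y = (x::D4)"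
definition less_D4 :: "D4 \<Rightarrow> D4 \<Rightarrow> bool" where "x < y \<longleftrightarrow> x \<le> y \<and> x \<noteq> (y::D4)"

instance ..

end

instance D4 :: lattice
proof -
  have comm: "x \<sqinter> y = y \<sqinter> x" "x \<squnion> y = y \<squnion> x" for x y :: D4
    by (transfer, rule meq.comm_Meet) (transfer, rule meq.comm_Join)
  have assoc: "(x \<sqinter> y) \<sqinter> z = x \<sqinter> (y \<sqinter> z)" "(x \<squnion> y) \<squnion> z = x \<squnion> (y \<squnion> z)" for x y z :: D4
    by (transfer, rule meq.assoc_Meet) (transfer, rule meq.assoc_Join)
  have absorb: "x \<sqinter> (x \<squnion> y) = x" "x \<squnion> (x \<sqinter> y) = x" for x y :: D4
    by (transfer, rule meq.absorb_Meet) (transfer, rule meq.absorb_Join)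
  have idem: "x \<sqinter> x = x" for x :: D4
    by (metis absorb)
  have le_sup: "x \<le> y \<longleftrightarrow> x \<squnion> y = y" for x y :: D4
    unfolding less_eq_D4_def by (metis absorb comm)
  show "OFCLASS(D4, lattice_class)"
  proof
    fix x y z :: D4
    show "x < y \<longleftrightarrow> x \<le> y \<and> \<not> y \<le> x"
      unfolding less_D4_def less_eq_D4_def by (metis comm idem)
    show "x \<le> x" unfolding less_eq_D4_def by (rule idem)
    show "x \<le> y \<Longrightarrow> y \<le> z \<Longrightarrow> x \<le> z"
      unfolding less_eq_D4_def by (metis assoc)
    show "x \<le> y \<Longrightarrow> y \<le> x \<Longrightarrow> x = y"
      unfolding less_eq_D4_def by (metis comm)
    show "x \<sqinter> y \<le> x" "x \<sqinter> y \<le> y"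
      unfolding less_eq_D4_def by (metis assoc comm idem)+
    show "x \<le> y \<Longrightarrow> x \<le> z \<Longrightarrow> x \<le> y \<sqinter> z"
      unfolding less_eq_D4_def by (metis assoc)
    show "x \<le> x \<squnion> y" "y \<le> x \<squnion> y"
      unfolding less_eq_D4_def by (metis absorb comm)+
    show "y \<le> x \<Longrightarrow> z \<le> x \<Longrightarrow> y \<squnion> z \<le> x"
      unfolding le_sup by (metis assoc)
  qed
qed

instance D4 :: modular_lattice
proof
  fix x y z :: D4
  assume "x \<le> z"
  moreover have "(x \<sqinter> z) \<squnion> (y \<sqinter> z) = ((x \<sqinter> z) \<squnion> y) \<sqinter> z"
    by transfer (rule meq.modular)
  ultimately show "x \<squnion> (y \<sqinter> z) = (x \<squnion> y) \<sqinter> z"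
    by (simp add: inf_absorb1)
qed

lemma D4_induct [case_names gen join meet]:
  assumes "\<And>i. P (e i)"
    and "\<And>x y. P x \<Longrightarrow> P y \<Longrightarrow> P (x \<squnion> y)"
    and "\<And>x y. P x \<Longrightarrow> P y \<Longrightarrow> P (x \<sqinter> y)"
  shows "P x"
proof -
  have "P (abs_D4 s)" for s
  proof (induction s)
    case (Gen i)
    then show ?case using assms(1)[of i] by (simp add: e.abs_eq)
  next
    case (Join s t)
    then show ?case using assms(2) by (simp flip: sup_D4.abs_eq)
  next
    case (Meet s t)
    then show ?case using assms(3) by (simp flip: inf_D4.abs_eq)
  qed
  then show ?thesis by (metis Quotient3_D4 Quotient3_abs_rep)
qed

text \<open>The universal property: every assignment of the generators into a modular lattice extends
  uniquely to a lattice homomorphism.\<close>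

primrec meval :: "(idx \<Rightarrow> 'b::modular_lattice) \<Rightarrow> mterm \<Rightarrow> 'b" where
  "meval h (Gen i) = h i"
| "meval h (Join s t) = meval h s \<squnion> meval h t"
| "meval h (Meet s t) = meval h s \<sqinter> meval h t"

lemma meval_meq: "s \<doteq> t \<Longrightarrow> meval h s = meval h t"
proof (induction rule: meq.induct)
  case (modular s u t)
  show ?case using modular_lattice_class.modular[of "meval h s \<sqinter> meval h u"] by simp
qed (simp_all add: sup.commute inf.commute sup.left_commute inf.left_commute)

theorem D4_free:
  fixes h :: "idx \<Rightarrow> 'b::modular_lattice"
  shows "\<exists>!\<phi>. (\<forall>i. \<phi> (e i) = h i) \<and> (\<forall>x y. \<phi> (x \<squnion> y) = \<phi> x \<squnion> \<phi> y) \<and>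
    (\<forall>x y. \<phi> (x \<sqinter> y) = \<phi> x \<sqinter> \<phi> y)"
proof (rule ex_ex1I)
  define \<phi> where "\<phi> x = meval h (rep_D4 x)" for x
  have abs: "\<phi> (abs_D4 s) = meval h s" for s
    unfolding \<phi>_def by (intro meval_meq) (metis Quotient3_D4 rep_abs_rsp_left meq.refl)
  have rep: "\<exists>s. x = abs_D4 s" for x
    by (metis Quotient3_D4 Quotient3_abs_rep)
  have "\<phi> (e i) = h i" for i by (simp add: e.abs_eq abs)
  moreover have "\<phi> (x \<squnion> y) = \<phi> x \<squnion> \<phi> y" for x y
    using rep[of x] rep[of y] by (auto simp: sup_D4.abs_eq abs)
  moreover have "\<phi> (x \<sqinter> y) = \<phi> x \<sqinter> \<phi> y" for x y
    using rep[of x] rep[of y] by (auto simp: inf_D4.abs_eq abs)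
  ultimately show "\<exists>\<phi>. (\<forall>i. \<phi> (e i) = h i) \<and> (\<forall>x y. \<phi> (x \<squnion> y) = \<phi> x \<squnion> \<phi> y) \<and>
    (\<forall>x y. \<phi> (x \<sqinter> y) = \<phi> x \<sqinter> \<phi> y)" by blast
next
  fix \<phi> \<psi> :: "D4 \<Rightarrow> 'b"
  assume "(\<forall>i. \<phi> (e i) = h i) \<and> (\<forall>x y. \<phi> (x \<squnion> y) = \<phi> x \<squnion> \<phi> y) \<and> (\<forall>x y. \<phi> (x \<sqinter> y) = \<phi> x \<sqinter> \<phi> y)"
    and "(\<forall>i. \<psi> (e i) = h i) \<and> (\<forall>x y. \<psi> (x \<squnion> y) = \<psi> x \<squnion> \<psi> y) \<and> (\<forall>x y. \<psi> (x \<sqinter> y) = \<psi> x \<sqinter> \<psi> y)"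
  then have "\<phi> x = \<psi> x" for x by (induction x rule: D4_induct) auto
  then show "\<phi> = \<psi>" by blast
qed

instantiation D4 :: order_top
begin

definition top_D4 :: D4 where "\<top> = e n1 \<squnion> e n2 \<squnion> e n3 \<squnion> e n4"

instance
proof
  fix x :: D4
  show "x \<le> \<top>"
  proof (induction x rule: D4_induct)
    case (gen i)
    show ?case unfolding top_D4_def by (cases i) (auto intro: le_supI1 le_supI2)
  next
    case (meet x y)
    then show ?case by (metis inf.coboundedI1)
  qed simp
qed

end

section \<open>Atomic elements\<close>

text \<open>The two indices different from \<open>i\<close> and \<open>j\<close>. Their order is arbitrary, see
  \<open>a_Suc\<close> below.\<close>

definition rest :: "idx \<Rightarrow> idx \<Rightarrow> idx \<times> idx" where
  "rest i j = (let ks = filter (\<lambda>k. k \<noteq> i \<and> k \<noteq> j) [n1, n2, n3, n4] in (ks ! 0, ks ! 1))"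

text \<open>\<open>a i j n\<close> is $a^{ij}_n$.\<close>

primrec a_aux :: "nat \<Rightarrow> idx \<Rightarrow> idx \<Rightarrow> D4" where
  "a_aux 0 i j = \<top>"
| "a_aux (Suc n) i j = e i \<squnion> (e j \<sqinter> (case rest i j of (k, l) \<Rightarrow> a_aux n k l))"

definition a :: "idx \<Rightarrow> idx \<Rightarrow> nat \<Rightarrow> D4" where
  "a i j n = a_aux n i j"

lemma rest_cases:
  assumes "{i, j, k, l} = (UNIV :: idx set)"
  shows "rest i j = (k, l) \<or> rest i j = (l, k)"
  using assms unfolding UNIV_idx
  by (cases i; cases j; cases k; cases l) (auto simp: rest_def)

lemma e_a_commute:
  assumes "{i, j, k, l} = (UNIV :: idx set)"
  shows "e j \<sqinter> a k l n = e j \<sqinter> a l k n"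
  using assms
proof (induction n arbitrary: i j k l)
  case 0
  show ?case by (simp add: a_def)
next
  case (Suc n)
  let ?b = "a j i n"
  have U: "{k, l, i, j} = (UNIV :: idx set)" "{l, k, i, j} = (UNIV :: idx set)"
    "{k, l, j, i} = (UNIV :: idx set)" "{l, k, j, i} = (UNIV :: idx set)"
    using Suc.prems by blast+
  have k: "e k \<sqinter> a i j n = e k \<sqinter> ?b" and l: "e l \<sqinter> a i j n = e l \<sqinter> ?b"
    using Suc.IH[OF U(2)] Suc.IH[OF U(1)] by simp_all
  have kl: "a k l (Suc n) = e k \<squnion> (e l \<sqinter> ?b)"
    using rest_cases[OF U(1)] l by (auto simp: a_def)
  have lk: "a l k (Suc n) = e l \<squnion> (e k \<sqinter> ?b)"
    using rest_cases[OF U(2)] k by (auto simp: a_def)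
  have jb: "e j \<le> ?b" by (cases n) (simp_all add: a_def)
  have 1: "(e k \<squnion> (e l \<sqinter> ?b)) \<sqinter> ?b = (e k \<sqinter> ?b) \<squnion> (e l \<sqinter> ?b)"
    using modular_lattice_class.modular[of "e l \<sqinter> ?b" ?b "e k"] by (simp add: sup_commute)
  have 2: "(e l \<squnion> (e k \<sqinter> ?b)) \<sqinter> ?b = (e k \<sqinter> ?b) \<squnion> (e l \<sqinter> ?b)"
    using modular_lattice_class.modular[of "e k \<sqinter> ?b" ?b "e l"] by (simp add: sup_commute)
  have "e j \<sqinter> x = e j \<sqinter> (x \<sqinter> ?b)" for x
    using jb by (metis inf.absorb1 inf.commute inf.left_commute)
  then show ?case unfolding kl lk using 1 2 by metis
qed

lemma a_0: "a i j 0 = \<top>"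
  by (simp add: a_def)

lemma a_Suc:
  assumes "{i, j, k, l} = (UNIV :: idx set)"
  shows "a i j (Suc n) = e i \<squnion> (e j \<sqinter> a k l n)"
proof -
  have "e j \<sqinter> a k l n = e j \<sqinter> a l k n" by (rule e_a_commute[OF assms])
  then show ?thesis using rest_cases[OF assms] by (auto simp: a_def)
qed

section \<open>Admissible sequences\<close>

text \<open>The sequence $i_n \dots i_1$ is the list \<open>[i\<^sub>n, \<dots>, i\<^sub>1]\<close>, so its end is \<open>hd\<close>
  and its start is \<open>last\<close>.\<close>

definition admissible :: "idx list \<Rightarrow> bool" where
  "admissible \<alpha> \<longleftrightarrow> \<alpha> \<noteq> [] \<and> distinct_adj \<alpha>"

inductive replace :: "idx list \<Rightarrow> idx list \<Rightarrow> bool" where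
  "{i, j, k, l} = UNIV \<Longrightarrow> replace (\<beta> @ [i, j, l] @ \<gamma>) (\<beta> @ [i, k, l] @ \<gamma>)"

text \<open>The identification of sequences; \<open>replace\<close> is symmetric.\<close>

definition same_seq :: "idx list \<Rightarrow> idx list \<Rightarrow> bool" where
  "same_seq = replace\<^sup>*\<^sup>*"

text \<open>\<open>pw p q t\<close> is $(pq)^t$.\<close>

definition pw :: "idx \<Rightarrow> idx \<Rightarrow> nat \<Rightarrow> idx list" where
  "pw p q t = concat (replicate t [p, q])"

section \<open>Admissible elements\<close>

text \<open>
  \<open>row p\<^sub>1 p\<^sub>2 p\<^sub>3 p\<^sub>4 \<alpha> x y\<close>: the sequence \<open>\<alpha>\<close>, which starts at \<open>p\<^sub>1\<close>, has one of the eight normal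
  forms, \<open>x\<close> is $e_\alpha$ and \<open>y\<close> is $f_{\alpha0}$; the tabulated formulas are those for
  \<open>p\<^sub>i = i\<close>. Where the literature offers several expressions for an element, one without negative
  lower indices is used. The side conditions on \<open>r, s, t\<close> say that all lower indices of the
  expression used for $e_\alpha$ are non-negative and, in \<open>H1\<close>, that the sequence really has the end
  \<open>p\<^sub>1\<close>. No admissible sequence is lost by them: for instance \<open>2(31)\<^sup>s(21)\<^sup>t\<close> with \<open>s \<ge> 1\<close> is
  identified with \<open>2(41)(31)\<^sup>s\<^sup>-\<^sup>1(21)\<^sup>t\<close>, and \<open>(14)\<^sup>r(21)\<^sup>t\<close> with \<open>t \<ge> 1\<close> is identified
  with \<open>(14)\<^sup>r(31)(21)\<^sup>t\<^sup>-\<^sup>1\<close>.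

  The usual expression for $f_{\alpha0}$ in \<open>G2\<close> has the lower index \<open>2t - 1\<close>. For \<open>t = 0\<close> the
  expression of \<open>G4\<close> is used, transported along the interchange of 2 and 4, which maps the family of
  sequences of \<open>G4\<close> to that of \<open>G2\<close>; \<open>G3\<close> is treated in the same way.

  The alternative expressions are not interchangeable throughout. Take \<open>e\<^sub>1 = e\<^sub>2 = \<langle>u\<rangle>\<close>,
  \<open>e\<^sub>3 = \<langle>v\<rangle>\<close>, \<open>e\<^sub>4 = \<langle>u + v\<rangle>\<close> in a plane: then $e_1a^{23}_3a^{24}_1a^{34}_1 = e_1$, whereas
  $e_1a^{23}_1a^{24}_1a^{34}_3 = 0$. In \<open>H1\<close> with \<open>r = s = t = 1\<close> the second element is the right one.
\<close>

inductive row :: "idx \<Rightarrow> idx \<Rightarrow> idx \<Rightarrow> idx \<Rightarrow> idx list \<Rightarrow> D4 \<Rightarrow> D4 \<Rightarrow> bool"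
  for p1 p2 p3 p4 where
  F2: "1 \<le> t \<Longrightarrow>
    x = e p2 \<sqinter> a p3 p1 (2*s) \<sqinter> a p4 p1 (2*r) \<sqinter> a p3 p4 (2*t-1) \<Longrightarrow>
    row p1 p2 p3 p4 (pw p2 p1 t @ pw p4 p1 r @ pw p3 p1 s) x
      (x \<sqinter> (a p4 p3 (2*t) \<squnion> (e p1 \<sqinter> a p2 p4 (2*r) \<sqinter> a p2 p3 (2*s))))"
| F3: "1 \<le> s \<Longrightarrow>
    x = e p3 \<sqinter> a p2 p1 (2*t) \<sqinter> a p4 p1 (2*r) \<sqinter> a p2 p4 (2*s-1) \<Longrightarrow>
    row p1 p2 p3 p4 (pw p3 p1 s @ pw p4 p1 r @ pw p2 p1 t) x
      (x \<sqinter> (a p4 p2 (2*s) \<squnion> (e p1 \<sqinter> a p3 p4 (2*r) \<sqinter> a p3 p2 (2*t))))"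
| F4: "1 \<le> r \<Longrightarrow>
    x = e p4 \<sqinter> a p2 p1 (2*t) \<sqinter> a p3 p1 (2*s) \<sqinter> a p3 p2 (2*r-1) \<Longrightarrow>
    row p1 p2 p3 p4 (pw p4 p1 r @ pw p3 p1 s @ pw p2 p1 t) x
      (x \<sqinter> (a p3 p2 (2*r) \<squnion> (e p1 \<sqinter> a p4 p3 (2*s) \<sqinter> a p4 p2 (2*t))))"
| G1: "x = e p1 \<sqinter> a p2 p4 (2*s) \<sqinter> a p3 p4 (2*t) \<sqinter> a p3 p2 (2*r) \<Longrightarrow>
    row p1 p2 p3 p4 (p1 # pw p4 p1 r @ pw p3 p1 s @ pw p2 p1 t) x
      (x \<sqinter> (a p3 p2 (2*r+1) \<squnion> (e p4 \<sqinter> a p2 p1 (2*s) \<sqinter> a p3 p1 (2*t))))"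
| G2: "1 \<le> r \<Longrightarrow>
    x = e p2 \<sqinter> a p3 p4 (2*t) \<sqinter> a p3 p1 (2*s+1) \<sqinter> a p1 p4 (2*r-1) \<Longrightarrow>
    row p1 p2 p3 p4 (p2 # pw p4 p1 r @ pw p3 p1 s @ pw p2 p1 t) x
      (x \<sqinter> ((e p2 \<sqinter> a p1 p4 (2*r)) \<squnion>
        (if 1 \<le> t then a p3 p1 (2*s+2) \<sqinter> a p3 p4 (2*t-1)
         else a p3 p1 (2*s) \<sqinter> a p3 p4 (2*t+1))))"
| G3: "1 \<le> r \<Longrightarrow>
    x = e p3 \<sqinter> a p2 p4 (2*s) \<sqinter> a p2 p1 (2*t+1) \<sqinter> a p1 p4 (2*r-1) \<Longrightarrow>
    row p1 p2 p3 p4 (p3 # pw p4 p1 r @ pw p2 p1 t @ pw p3 p1 s) x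
      (x \<sqinter> ((e p3 \<sqinter> a p1 p4 (2*r)) \<squnion>
        (if 1 \<le> s then a p2 p1 (2*t+2) \<sqinter> a p2 p4 (2*s-1)
         else a p2 p1 (2*t) \<sqinter> a p2 p4 (2*s+1))))"
| G4: "1 \<le> t \<Longrightarrow>
    x = e p4 \<sqinter> a p3 p2 (2*r) \<sqinter> a p3 p1 (2*s+1) \<sqinter> a p1 p2 (2*t-1) \<Longrightarrow>
    row p1 p2 p3 p4 (p4 # pw p2 p1 t @ pw p3 p1 s @ pw p4 p1 r) x
      (x \<sqinter> ((e p4 \<sqinter> a p1 p2 (2*t)) \<squnion> (a p3 p1 (2*s) \<sqinter> a p3 p2 (2*r+1))))"
| H1: "1 \<le> r \<Longrightarrow> 1 \<le> s \<Longrightarrow>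
    x = e p1 \<sqinter> a p2 p3 (2*r-1) \<sqinter> a p2 p4 (2*s-1) \<sqinter> a p3 p4 (2*t+1) \<Longrightarrow>
    row p1 p2 p3 p4 (pw p1 p4 r @ pw p3 p1 s @ pw p2 p1 t) x
      (x \<sqinter> ((e p1 \<sqinter> a p2 p3 (2*r)) \<squnion> (a p2 p4 (2*s) \<sqinter> a p3 p4 (2*t))))"

text \<open>Sequences starting at \<open>m\<close> are obtained by interchanging \<open>1\<close> and \<open>m\<close>.\<close>

definition row_at :: "idx \<Rightarrow> idx list \<Rightarrow> D4 \<Rightarrow> D4 \<Rightarrow> bool" where
  "row_at m = (let \<tau> = id(n1 := m, m := n1) in row (\<tau> n1) (\<tau> n2) (\<tau> n3) (\<tau> n4))"

text \<open>\<open>is_e \<alpha> x\<close> says that \<open>x\<close> is $e_\alpha$ and \<open>is_f0 \<alpha> y\<close> that \<open>y\<close> is $f_{\alpha0}$.\<close>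

definition is_e :: "idx list \<Rightarrow> D4 \<Rightarrow> bool" where
  "is_e \<alpha> x \<longleftrightarrow> admissible \<alpha> \<and> (\<exists>m \<beta> y. same_seq \<alpha> \<beta> \<and> row_at m \<beta> x y)"

definition is_f0 :: "idx list \<Rightarrow> D4 \<Rightarrow> bool" where
  "is_f0 \<alpha> y \<longleftrightarrow> admissible \<alpha> \<and> (\<exists>m \<beta> x. same_seq \<alpha> \<beta> \<and> row_at m \<beta> x y)"

text \<open>
  The second factor of the unified form of $f_{\alpha0}$, which for \<open>r \<ge> 1\<close> is
  $e_i a^{jk}_{t+1} + a^{kl}_{s+1} a^{jl}_{r-1}$. An atomic element has no lower index \<open>-1\<close>, so for
  \<open>r = 0\<close> the index that is lowered is that of another one of the three atomic elements, whose
  index is positive. For \<open>r = s = t = 0\<close> there is none; the factor is then $e_j + e_k + e_l$,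
  corresponding to $f_{i0} = e_i(e_j + e_k + e_l)$.
\<close>

definition factor :: "idx \<Rightarrow> idx \<Rightarrow> idx \<Rightarrow> idx \<Rightarrow> nat \<Rightarrow> nat \<Rightarrow> nat \<Rightarrow> D4" where
  "factor i j k l t s r =
    (if 1 \<le> r then (e i \<sqinter> a j k (t+1)) \<squnion> (a k l (s+1) \<sqinter> a j l (r-1))
     else if 1 \<le> s then (e i \<sqinter> a j k (t+1)) \<squnion> (a j l (r+1) \<sqinter> a k l (s-1))
     else if 1 \<le> t then (e i \<sqinter> a k l (s+1)) \<squnion> (a j l (r+1) \<sqinter> a j k (t-1))
     else e j \<squnion> e k \<squnion> e l)"

end

theory Submission
  imports Defs
begin

text \<open>
  Fix an end \<open>i\<close> and let \<open>j, k, l\<close> be the other indices. Below $e_i$ the atomic elements form three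
  decreasing chains $e_ia^{jk}_n$, $e_ia^{kl}_n$, $e_ia^{lj}_n$, which do not depend on the order of the
  two upper indices. Every tabulated $e_\<alpha>$ ending at \<open>i\<close> is the meet of one member of each chain, and
  the table exhausts all triples of lower indices $(t, s, r)$ by parity: if all are even or all are odd,
  the sequence starts at \<open>i\<close> (\<open>G1\<close>, \<open>H1\<close>); otherwise one parity is in the minority, and the sequence
  starts at the index complementary to the pair that carries it (\<open>F2\<close>, \<open>F3\<close>, \<open>F4\<close> if the minority is odd
  and \<open>G2\<close>, \<open>G3\<close>, \<open>G4\<close> if it is even). This is part (a).

  For part (b) one has to see that the second factors, which look different from type to type,
  all cut out the same element. The reason is \<open>trace_of_join\<close>:
  $$e_ia^{jk}_t(a^{jk}_{t+1} + e_la^{ij}_pa^{ik}_{q+1}) = e_ia^{jk}_{t+1} + e_ia^{jk}_ta^{kl}_{p+1}a^{lj}_q.$$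
  On the right all terms lie below $e_i$: one chain is raised in the first term, one is raised and one
  lowered in the second. Three consequences carry the proof. The two chains that are raised may be exchanged,
  by the modular law alone (\<open>raise_main_swap\<close>). As the left-hand side with $p = s$, $q + 1 = r$ is
  essentially symmetric in \<open>j\<close> and \<open>k\<close>, the chain that is lowered may be exchanged too.
  Hence the element is symmetric in the three chains (\<open>f_pattern_swap\<close>,
  \<open>f_pattern_reflect\<close>), and it equals the unified form (\<open>f_pattern_factor\<close>). Finally, the right-hand side for
  $(p, q + 1)$ is also the one obtained, after exchanging \<open>j\<close> and \<open>k\<close>, for $(p + 2, q - 1)$,
  so that two units can be moved from one index to the other (\<open>trace_of_join_shift\<close>); this accounts
  for the formulas of the table in which the two even indices are interchanged (\<open>f_pattern_mixed\<close>).
\<close>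

section \<open>Modular lattices\<close>

lemma modular_meet_join: "x \<le> z \<Longrightarrow> z \<sqinter> (x \<squnion> y) = x \<squnion> (z \<sqinter> (y::'b::modular_lattice))"
  using modular_lattice_class.modular[of x z y] by (simp add: inf_commute)

text \<open>
  For subspaces: write a vector of \<open>z\<close> as a vector of \<open>x\<close> plus a vector of \<open>y\<close>. Its \<open>y\<close>-part
  lies in \<open>x + z\<close>, and then its \<open>x\<close>-part lies in the sum of the former and \<open>z\<close>. This lemma and
  the next one stand for such computations with components in an arbitrary modular lattice.
\<close>

lemma meet_join_perspective:
  fixes x y z :: "'b::modular_lattice"
  assumes "z \<le> x \<squnion> y"
  shows "z \<le> (y \<sqinter> (x \<squnion> z)) \<squnion> (x \<sqinter> ((y \<sqinter> (x \<squnion> z)) \<squnion> z))"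
proof -
  define y0 where "y0 = y \<sqinter> (x \<squnion> z)"
  have "x \<squnion> y0 = (x \<squnion> z) \<sqinter> (x \<squnion> y)"
    unfolding y0_def using modular_meet_join[of x "x \<squnion> z" y] by (simp add: inf_commute)
  then have "z \<le> x \<squnion> y0" using assms by simp
  then have "z \<le> (y0 \<squnion> z) \<sqinter> (y0 \<squnion> x)" by (simp add: sup_commute)
  also have "\<dots> = y0 \<squnion> ((y0 \<squnion> z) \<sqinter> x)" by (rule modular_meet_join) simp
  finally show ?thesis by (simp add: y0_def inf_commute)
qed

lemma meet_join_le:
  fixes x y z :: "'b::modular_lattice"
  shows "x \<sqinter> (y \<squnion> z) \<le> y \<squnion> (z \<sqinter> (x \<squnion> y))"
proof -
  have "x \<sqinter> (y \<squnion> z) \<le> (y \<squnion> x) \<sqinter> (y \<squnion> z)"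
    by (meson inf.coboundedI1 inf_le2 le_inf_iff sup_ge2 order_trans)
  also have "\<dots> = y \<squnion> ((y \<squnion> x) \<sqinter> z)" by (rule modular_meet_join) simp
  finally show ?thesis by (simp add: inf_commute sup_commute)
qed

text \<open>
  The right-hand side does not change when \<open>x, x'\<close> is exchanged with \<open>y, y'\<close>, so neither does the
  left-hand side. Here \<open>x, x'\<close> and \<open>y, y'\<close> stand for consecutive members of two decreasing chains and
  \<open>z', z\<close> for those of a third one.
\<close>

lemma raise_main_swap:
  fixes x y z :: "'b::modular_lattice"
  assumes "x' \<le> x" "y' \<le> y" "z \<le> z'"
  shows "x \<sqinter> y \<sqinter> z \<sqinter> (x' \<squnion> (x \<sqinter> y' \<sqinter> z')) = z \<sqinter> ((x' \<sqinter> y \<sqinter> z') \<squnion> (x \<sqinter> y' \<sqinter> z'))"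
proof -
  let ?w = "x \<sqinter> y' \<sqinter> z'"
  have "x \<sqinter> (x' \<squnion> ?w) = x' \<squnion> ?w" using assms(1) by (simp add: inf_absorb2 inf.coboundedI1)
  moreover have "(y \<sqinter> z') \<sqinter> (?w \<squnion> x') = ?w \<squnion> (y \<sqinter> z' \<sqinter> x')"
    using assms(2) by (intro modular_meet_join) (simp add: inf.coboundedI1 inf.coboundedI2)
  ultimately have "(y \<sqinter> z') \<sqinter> (x \<sqinter> (x' \<squnion> ?w)) = ?w \<squnion> (y \<sqinter> z' \<sqinter> x')"
    by (simp only: sup_commute)
  also have "\<dots> = (x' \<sqinter> y \<sqinter> z') \<squnion> ?w" by (simp add: sup_commute inf_aci)
  finally have "(y \<sqinter> z') \<sqinter> (x \<sqinter> (x' \<squnion> ?w)) = (x' \<sqinter> y \<sqinter> z') \<squnion> ?w" .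
  moreover have "x \<sqinter> y \<sqinter> z \<sqinter> (x' \<squnion> ?w) = z \<sqinter> ((y \<sqinter> z') \<sqinter> (x \<sqinter> (x' \<squnion> ?w)))"
  proof -
    have "x \<sqinter> y \<sqinter> z \<sqinter> v = z \<sqinter> (y \<sqinter> z' \<sqinter> (x \<sqinter> v))" for v
      by (subst inf_absorb1[OF assms(3), symmetric]) (simp only: inf_aci)
    then show ?thesis .
  qed
  ultimately show ?thesis by simp
qed

section \<open>Traces of the atomic elements below a generator\<close>

lemma indices_distinct:
  assumes "{i, j, k, l} = (UNIV :: idx set)"
  shows "i \<noteq> j" "i \<noteq> k" "i \<noteq> l" "j \<noteq> k" "j \<noteq> l" "k \<noteq> l"
    and "j \<noteq> i" "k \<noteq> i" "l \<noteq> i" "k \<noteq> j" "l \<noteq> j" "l \<noteq> k"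
proof -
  have "card {i, j, k, l} = 4" unfolding assms UNIV_idx by simp
  then show "i \<noteq> j" "i \<noteq> k" "i \<noteq> l" "j \<noteq> k" "j \<noteq> l" "k \<noteq> l"
    "j \<noteq> i" "k \<noteq> i" "l \<noteq> i" "k \<noteq> j" "l \<noteq> j" "l \<noteq> k"
    by (auto simp: card_insert_if split: if_splits)
qed

lemma indices_exist:
  assumes "i \<noteq> j" "i \<noteq> k" "j \<noteq> k"
  obtains l where "{i, j, k, l} = (UNIV :: idx set)"
proof -
  have "\<exists>l. {i, j, k, l} = (UNIV :: idx set)"
    using assms unfolding UNIV_idx by (cases i; cases j; cases k) auto
  then show ?thesis using that by blast
qed

lemma e_le_a: "e i \<le> a i j n"
  by (cases n) (simp_all add: a_def)

lemma a_antimono: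
  assumes "i \<noteq> j" "m \<le> n"
  shows "a i j n \<le> a i j m"
proof -
  have "a i j (Suc n) \<le> a i j n" if "i \<noteq> j" for i j n
    using that
  proof (induction n arbitrary: i j)
    case 0
    then show ?case by (simp add: a_0)
  next
    case (Suc n)
    obtain k where "k \<noteq> i" "k \<noteq> j" using Suc.prems by (cases i; cases j) auto
    then obtain l where U: "{i, j, k, l} = UNIV" using indices_exist[of i j k] Suc.prems by auto
    show ?case unfolding a_Suc[OF U]
      by (intro sup_mono inf_mono order_refl Suc.IH indices_distinct[OF U])
  qed
  then show ?thesis using lift_Suc_antimono_le[of "a i j"] assms by blast
qed

text \<open>
  Intersecting with $e_i$ makes the atomic elements symmetric in their upper indices, so that for fixed
  \<open>i\<close> there remain three decreasing chains below $e_i$, one for each pair of the other indices.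
\<close>

definition trace :: "idx \<Rightarrow> idx \<Rightarrow> idx \<Rightarrow> nat \<Rightarrow> D4" where
  "trace i j k n = e i \<sqinter> a j k n"

lemma trace_commute: "i \<noteq> j \<Longrightarrow> i \<noteq> k \<Longrightarrow> trace i j k n = trace i k j n"
proof (cases "j = k")
  case False
  assume "i \<noteq> j" "i \<noteq> k"
  then obtain l where "{j, k, i, l} = UNIV" using indices_exist[of j k i] False by metis
  then have "{l, i, j, k} = UNIV" by blast
  then show ?thesis unfolding trace_def by (rule e_a_commute)
qed simp

lemma trace_antimono: "j \<noteq> k \<Longrightarrow> m \<le> n \<Longrightarrow> trace i j k n \<le> trace i j k m"
  unfolding trace_def by (intro inf_mono order_refl a_antimono)

lemma trace_le_e: "trace i j k n \<le> e i" by (simp add: trace_def)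
lemma trace_le_a: "trace i j k n \<le> a j k n" by (simp add: trace_def)

lemma trace_0: "trace i j k 0 = e i" by (simp add: trace_def a_0 inf_absorb1)

lemma a_Suc_trace: "{i, j, k, l} = (UNIV :: idx set) \<Longrightarrow> a i j (Suc n) = e i \<squnion> trace j k l n"
  unfolding trace_def by (rule a_Suc)

text \<open>
  For subspaces: a vector \<open>y\<close> of the left-hand side is \<open>\<kappa> + \<lambda>\<close> with \<open>\<kappa>\<close> in $e_k$ and \<open>\<lambda>\<close> in
  $e_la^{ij}_p$, because it lies in $a^{kl}_{p+1}$. As \<open>y\<close> also lies in $a^{lj}_q$, which contains
  $e_l$, so does \<open>\<kappa>\<close>, and \<open>\<lambda> = y - \<kappa>\<close> lies in $e_i + e_ka^{lj}_q = a^{ik}_{q+1}$. Finally \<open>y\<close>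
  lies in $a^{kj}_t$, which contains $e_k$, so \<open>\<lambda>\<close> does as well and \<open>\<kappa> = y - \<lambda>\<close> lies in
  $e_i + e_la^{kj}_t = a^{il}_{t+1}$.
\<close>

lemma trace_decomposition:
  assumes U: "{i, j, k, l} = (UNIV :: idx set)"
  shows "trace i j k t \<sqinter> trace i k l (Suc p) \<sqinter> trace i l j q
    \<le> trace k i l t \<squnion> (e l \<sqinter> a i j p \<sqinter> a i k (Suc q))"
proof -
  note d = indices_distinct[OF U]
  have U': "{k, l, i, j} = UNIV" "{i, k, l, j} = UNIV" "{i, l, k, j} = UNIV"
    using U by auto
  let ?Y = "trace i j k t \<sqinter> trace i k l (Suc p) \<sqinter> trace i l j q"
  let ?K = "trace k l j q" and ?L = "e l \<sqinter> a i j p"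
  have K: "?K \<le> e k" by (rule trace_le_e)
  have "?Y \<le> a l j q \<sqinter> a k l (Suc p)"
    using trace_le_a[of i l j q] trace_le_a[of i k l "Suc p"] by (meson inf.coboundedI1 inf.coboundedI2 le_inf_iff)
  also have "\<dots> = a l j q \<sqinter> (?L \<squnion> e k)"
    unfolding a_Suc_trace[OF U'(1)] by (simp add: trace_def sup_commute)
  also have "\<dots> = ?L \<squnion> ?K"
    using modular_meet_join[of ?L "a l j q" "e k"] e_le_a[of l j q]
    by (simp add: trace_def inf_commute le_infI1 inf.coboundedI2)
  finally have "?Y \<le> e i \<sqinter> (?K \<squnion> ?L)"
    using trace_le_e[of i j k t] by (simp add: inf.coboundedI1 sup_commute)
  also have "\<dots> \<le> ?K \<squnion> (?L \<sqinter> (e i \<squnion> ?K))" by (rule meet_join_le)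
  also have "?L \<sqinter> (e i \<squnion> ?K) = ?L \<sqinter> a i k (Suc q)"
    by (simp add: a_Suc_trace[OF U'(2)])
  finally have Y: "?Y \<le> ?K \<squnion> (?L \<sqinter> a i k (Suc q))" .
  let ?M = "?L \<sqinter> a i k (Suc q)"
  have "?Y \<le> a k j t \<sqinter> (?K \<squnion> ?M)"
    using Y trace_le_a[of i k j t] trace_commute[of i j k t] d by (simp add: inf.coboundedI1)
  also have "\<dots> = ?K \<squnion> (a k j t \<sqinter> ?M)"
    using modular_meet_join[of ?K "a k j t" ?M] order_trans[OF K e_le_a] by blast
  finally have "?Y \<le> e i \<sqinter> ((a k j t \<sqinter> ?M) \<squnion> ?K)"
    using trace_le_e[of i j k t] by (simp add: inf.coboundedI1 sup_commute)
  also have "\<dots> \<le> (a k j t \<sqinter> ?M) \<squnion> (?K \<sqinter> (e i \<squnion> (a k j t \<sqinter> ?M)))" by (rule meet_join_le)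
  also have "\<dots> \<le> ?M \<squnion> trace k i l t"
  proof (rule sup_mono)
    have "a k j t \<sqinter> ?M \<le> trace l k j t"
      unfolding trace_def by (simp add: inf.coboundedI1 inf.coboundedI2)
    then have "e i \<squnion> (a k j t \<sqinter> ?M) \<le> a i l (Suc t)"
      unfolding a_Suc_trace[OF U'(3)] by (rule sup_mono[OF order_refl])
    also have "\<dots> \<le> a i l t" using d by (intro a_antimono) auto
    finally show "?K \<sqinter> (e i \<squnion> (a k j t \<sqinter> ?M)) \<le> trace k i l t"
      unfolding trace_def using K by (simp add: inf.coboundedI1 inf.coboundedI2)
  qed (rule inf_le2)
  finally show ?thesis by (simp add: sup_commute)
qed

text \<open>
  The central computation: the part below $e_i$ of a join whose terms need not lie below $e_i$ is
  itself a join of traces, and one of the lower indices drops from \<open>q + 1\<close> to \<open>q\<close>. For the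
  inclusion from left to right, let a vector \<open>v\<close> of the left-hand side be $\<beta> + \<lambda>$ with \<open>\<beta>\<close> in \<open>b\<close>
  and \<open>\<lambda>\<close> in $e_la^{ij}_pa^{ik}_{q+1}$; as \<open>v\<close> and \<open>\<beta>\<close> lie in $a^{jk}_t$, so does \<open>\<lambda>\<close>. Since $a^{ik}_{q+1} = e_i + e_ka^{lj}_q$, we have $\<lambda> = y - \<kappa>$ with
  \<open>y\<close> in $e_i$ and \<open>\<kappa>\<close> in $e_ka^{lj}_q$. This \<open>y\<close> belongs to the last three traces, \<open>\<kappa>\<close> belongs to
  \<open>b\<close>, and so $v - y$ belongs to $e_ib$, which is the first trace for both choices of \<open>b\<close>.
\<close>

lemma trace_of_join:
  assumes U: "{i, j, k, l} = (UNIV :: idx set)"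
    and b: "b = a j k (Suc t) \<or> b = a k j (Suc t)"
  shows "trace i j k t \<sqinter> (b \<squnion> (e l \<sqinter> a i j p \<sqinter> a i k (Suc q)))
    = trace i j k (Suc t) \<squnion> (trace i j k t \<sqinter> trace i k l (Suc p) \<sqinter> trace i l j q)" (is "?X = ?A' \<squnion> ?Y")
proof (rule order.antisym)
  note d = indices_distinct[OF U]
  have U': "{k, l, i, j} = UNIV" "{i, k, l, j} = UNIV" "{i, l, k, j} = UNIV" "{j, k, i, l} = UNIV"
     "{k, j, i, l} = UNIV"
    using U by auto
  have b_ge: "trace k i l t \<le> b"
    using b unfolding a_Suc_trace[OF U'(4)] a_Suc_trace[OF U'(5)]
    by (auto intro: le_supI1 trace_le_e)
  have b_trace: "e i \<sqinter> b = ?A'"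
    using b trace_commute[of i j k] d unfolding trace_def by metis
  have A_b: "trace i j k t = e i \<sqinter> a j k t" "trace i j k t = e i \<sqinter> a k j t"
    using trace_commute[of i j k] d unfolding trace_def by metis+
  let ?L = "e l \<sqinter> a i j p \<sqinter> a i k (Suc q)"
  show "?A' \<squnion> ?Y \<le> ?X"
  proof (intro sup_least le_infI)
    show "?A' \<le> trace i j k t" using d by (intro trace_antimono) auto
    show "?A' \<le> b \<squnion> ?L" unfolding b_trace[symmetric] by (simp add: le_supI1)
    show "?Y \<le> trace i j k t" by (simp add: inf.coboundedI1)
    show "?Y \<le> b \<squnion> ?L"
      using trace_decomposition[OF U, of t p q] b_ge by (meson order_trans sup_mono order_refl)
  qed
  \<comment> \<open>only the part of $e_la^{ij}_pa^{ik}_{q+1}$ inside $a^{jk}_t$ matters, as \<open>b\<close> and the trace lie there\<close>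
  define M where "M = ?L \<sqinter> a j k t"
  have M_alt: "M = ?L \<sqinter> a k j t"
  proof -
    have "M = trace l j k t \<sqinter> a i j p \<sqinter> a i k (Suc q)" by (simp add: M_def trace_def inf_aci)
    also have "trace l j k t = trace l k j t" using d by (intro trace_commute) auto
    finally show ?thesis by (simp add: trace_def inf_aci)
  qed
  \<comment> \<open>splitting \<open>M\<close> along $e_k$ and $e_i$: \<open>K0\<close> is spanned by the components in $e_k$\<close>
  define K0 where "K0 = trace k l j q \<sqinter> (e i \<squnion> M)"
  define y where "y = e i \<sqinter> (K0 \<squnion> M)"
  have "M \<le> e i \<squnion> trace k l j q"
    unfolding a_Suc_trace[OF U'(2), symmetric] M_def by (simp add: inf.coboundedI1 inf.coboundedI2)
  then have M: "M \<le> K0 \<squnion> y"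
    unfolding K0_def y_def by (rule meet_join_perspective)
  have K0e: "K0 \<le> e k" unfolding K0_def using trace_le_e by (rule le_infI1)
  have "M \<le> trace l k j t" unfolding M_alt trace_def by (simp add: inf.coboundedI1)
  then have "e i \<squnion> M \<le> a i l (Suc t)"
    unfolding a_Suc_trace[OF U'(3)] by (rule sup_mono[OF order_refl])
  also have "\<dots> \<le> a i l t" using d by (intro a_antimono) auto
  finally have "K0 \<le> trace k i l t"
    unfolding trace_def using K0e by (simp add: K0_def inf.coboundedI2)
  then have K0: "K0 \<le> b" using b_ge by (rule order_trans)
  have y: "y \<le> ?Y"
  proof -
    have "K0 \<squnion> M \<le> a k j t"
      using order_trans[OF K0e e_le_a] by (simp add: M_alt)
    moreover have "K0 \<squnion> M \<le> a k l (Suc p)"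
      unfolding a_Suc_trace[OF U'(1)] using K0e
      by (intro sup_mono) (simp_all add: M_def trace_def inf.coboundedI1)
    moreover have "K0 \<squnion> M \<le> a l j q"
    proof (rule sup_least)
      show "K0 \<le> a l j q" unfolding K0_def by (intro le_infI1 trace_le_a)
      show "M \<le> a l j q" unfolding M_def
        by (intro le_infI1 e_le_a)
    qed
    ultimately show ?thesis unfolding y_def
      by (subst A_b(2), unfold trace_def, intro le_infI inf_le1; elim le_infI2)
  qed
  have "?X \<le> e i \<sqinter> (b \<squnion> M)"
  proof -
    \<comment> \<open>the orientation of $a^{jk}_t$ that lies above \<open>b\<close>\<close>
    obtain c where c: "c = a j k t \<or> c = a k j t" "b \<le> c"
      using b a_antimono[OF d(4), of t "Suc t"] a_antimono[OF d(10), of t "Suc t"]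
      by fastforce
    have M_c: "M = c \<sqinter> ?L" using c(1) M_def M_alt inf_commute[of ?L c] by auto
    have "trace i j k t = e i \<sqinter> c" using c(1) A_b by auto
    then have "?X = e i \<sqinter> (c \<sqinter> (b \<squnion> ?L))" by (simp only: inf_assoc)
    also have "c \<sqinter> (b \<squnion> ?L) = b \<squnion> M"
      unfolding M_c using c(2) by (rule modular_meet_join)
    finally show ?thesis by simp
  qed
  also have "\<dots> \<le> e i \<sqinter> (y \<squnion> b)"
  proof (rule inf_mono[OF order_refl])
    have "K0 \<squnion> y \<le> y \<squnion> b" using K0 by (simp add: le_supI2)
    then show "b \<squnion> M \<le> y \<squnion> b" using M by (simp add: order_trans)
  qed
  also have "\<dots> = y \<squnion> ?A'"
    unfolding b_trace[symmetric] by (rule modular_meet_join) (simp add: y_def)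
  also have "\<dots> \<le> ?A' \<squnion> ?Y" using y by (simp add: le_supI2)
  finally show "?X \<le> ?A' \<squnion> ?Y" .
qed

section \<open>The two patterns and their symmetry\<close>

definition e_pattern :: "idx \<Rightarrow> idx \<Rightarrow> idx \<Rightarrow> idx \<Rightarrow> nat \<Rightarrow> nat \<Rightarrow> nat \<Rightarrow> D4" where
  "e_pattern i j k l t s r = trace i j k t \<sqinter> trace i k l s \<sqinter> trace i l j r"

text \<open>
  The pattern of $f_{\<alpha>0}$ is that of $e_\<alpha>$ cut down by $a^{jk}_{t+1} + e_la^{ij}_sa^{ik}_r$. Unlike
  the expressions that lower an index, it makes sense for all $r, s, t \<ge> 0$. The indices \<open>s\<close> and \<open>r\<close> on
  $a^{ij}$ and $a^{ik}$ are those of the traces on the complementary pairs $kl$ and $lj$.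
\<close>

definition f_pattern :: "idx \<Rightarrow> idx \<Rightarrow> idx \<Rightarrow> idx \<Rightarrow> nat \<Rightarrow> nat \<Rightarrow> nat \<Rightarrow> D4" where
  "f_pattern i j k l t s r = e_pattern i j k l t s r \<sqinter> (a j k (Suc t) \<squnion> (e l \<sqinter> a i j s \<sqinter> a i k r))"

lemma e_pattern_swap:
  assumes U: "{i, j, k, l} = (UNIV :: idx set)"
  shows "e_pattern i j k l t s r = e_pattern i k j l t r s"
  unfolding e_pattern_def using indices_distinct[OF U]
  by (simp add: trace_commute[of i j k] trace_commute[of i k l] trace_commute[of i l j] inf_aci)

lemma e_pattern_reflect:
  assumes U: "{i, j, k, l} = (UNIV :: idx set)"
  shows "e_pattern i j k l t s r = e_pattern i l k j s t r"
  unfolding e_pattern_def using indices_distinct[OF U]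
  by (simp add: trace_commute[of i j k] trace_commute[of i k l] trace_commute[of i l j] inf_aci)

lemma e_pattern_le: "e_pattern i j k l t s r \<le> trace i j k t"
  by (simp add: e_pattern_def inf.coboundedI1)

lemma f_pattern_lower:
  assumes U: "{i, j, k, l} = (UNIV :: idx set)"
    and b: "b = a j k (Suc t) \<or> b = a k j (Suc t)"
  shows "e_pattern i j k l t s (Suc r) \<sqinter> (b \<squnion> (e l \<sqinter> a i j s \<sqinter> a i k (Suc r)))
     = e_pattern i j k l t s (Suc r) \<sqinter> (trace i j k (Suc t) \<squnion> (trace i j k t \<sqinter> trace i k l (Suc s) \<sqinter> trace i l j r))"
proof -
  let ?E = "e_pattern i j k l t s (Suc r)"
  have "?E = ?E \<sqinter> trace i j k t" by (simp add: e_pattern_le inf_absorb1)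
  then have "?E \<sqinter> x = ?E \<sqinter> (trace i j k t \<sqinter> x)" for x by (metis inf_assoc)
  then show ?thesis by (metis trace_of_join[OF U b])
qed

text \<open>
  Both orientations of $a^{jk}_{t+1}$ have the same trace below $e_i$, so that \<open>f_pattern_lower\<close> gives the same
  value for both.
\<close>

lemma f_pattern_swap_pos:
  assumes U: "{i, j, k, l} = (UNIV :: idx set)"
  shows "f_pattern i j k l t s (Suc r) = f_pattern i k j l t (Suc r) s"
proof -
  have "e l \<sqinter> a i j s \<sqinter> a i k (Suc r) = e l \<sqinter> a i k (Suc r) \<sqinter> a i j s" by (simp add: inf_aci)
  then show ?thesis
    unfolding f_pattern_def e_pattern_swap[OF U, of t s "Suc r", symmetric]
    by (metis f_pattern_lower[OF U])
qed

lemma f_pattern_reflect_pos: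
  assumes U: "{i, j, k, l} = (UNIV :: idx set)"
  shows "f_pattern i j k l t s (Suc r) = f_pattern i l k j s t (Suc r)"
proof -
  note d = indices_distinct[OF U]
  have U': "{i, l, k, j} = UNIV" using U by auto
  have c: "trace i l k n = trace i k l n" "trace i k j n = trace i j k n" "trace i l j n = trace i j l n" for n
    using d by (simp_all add: trace_commute)
  have "f_pattern i j k l t s (Suc r) = trace i j k t \<sqinter> trace i k l s \<sqinter> trace i l j (Suc r) \<sqinter>
    (trace i j k (Suc t) \<squnion> (trace i j k t \<sqinter> trace i k l (Suc s) \<sqinter> trace i l j r))"
    unfolding f_pattern_def using f_pattern_lower[OF U] by (simp add: e_pattern_def)
  also have "\<dots> = trace i l j (Suc r) \<sqinter> ((trace i j k (Suc t) \<sqinter> trace i k l s \<sqinter> trace i l j r) \<squnion>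
     (trace i j k t \<sqinter> trace i k l (Suc s) \<sqinter> trace i l j r))"
    using d by (intro raise_main_swap trace_antimono) auto
  also have "\<dots> = trace i j l (Suc r) \<sqinter> ((trace i l k (Suc s) \<sqinter> trace i k j t \<sqinter> trace i j l r) \<squnion>
     (trace i l k s \<sqinter> trace i k j (Suc t) \<sqinter> trace i j l r))"
    unfolding c by (simp add: sup_commute inf_aci)
  also have "\<dots> = trace i l k s \<sqinter> trace i k j t \<sqinter> trace i j l (Suc r) \<sqinter>
    (trace i l k (Suc s) \<squnion> (trace i l k s \<sqinter> trace i k j (Suc t) \<sqinter> trace i j l r))"
    using d by (intro raise_main_swap[symmetric] trace_antimono) auto
  also have "\<dots> = f_pattern i l k j s t (Suc r)"
    unfolding f_pattern_def using f_pattern_lower[OF U'] by (simp add: e_pattern_def)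
  finally show ?thesis .
qed

text \<open>
  If two of the indices vanish, then the traces on \<open>jk\<close> and on \<open>lj\<close> may both serve as the one that is
  raised: the joins in question are one and the same. This covers the cases in which no index other
  than that of the raised trace can be lowered.
\<close>

lemma f_pattern_two_zero:
  assumes U: "{i, j, k, l} = (UNIV :: idx set)"
  shows "f_pattern i j k l t 0 0 = e_pattern i j k l t 0 0 \<sqinter> (e j \<squnion> e l \<squnion> trace k i l t)"
    and "f_pattern i l j k 0 t 0 = e_pattern i j k l t 0 0 \<sqinter> (e j \<squnion> e l \<squnion> trace k i l t)"
proof -
  note d = indices_distinct[OF U]
  have U': "{j, k, i, l} = UNIV" "{l, j, k, i} = UNIV" "{i, l, j, k} = UNIV" using U by auto
  show "f_pattern i j k l t 0 0 = e_pattern i j k l t 0 0 \<sqinter> (e j \<squnion> e l \<squnion> trace k i l t)"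
    unfolding f_pattern_def a_Suc_trace[OF U'(1)] by (simp add: a_0 inf_absorb1 sup_aci)
  have "e_pattern i l j k 0 t 0 = e_pattern i j k l t 0 0" by (simp add: e_pattern_def inf_aci trace_0)
  then show "f_pattern i l j k 0 t 0 = e_pattern i j k l t 0 0 \<sqinter> (e j \<squnion> e l \<squnion> trace k i l t)"
    unfolding f_pattern_def a_Suc_trace[OF U'(2)] by (simp add: a_0 trace_0 trace_def inf_absorb1 sup_aci)
qed

text \<open>
  If only $t$ is positive, the exchange takes a detour: by \<open>f_pattern_two_zero\<close> the pattern can be written with
  another raised trace, and then \<open>t\<close> is an index that can be lowered.
\<close>

lemma f_pattern_swap:
  assumes U: "{i, j, k, l} = (UNIV :: idx set)"
  shows "f_pattern i j k l t s r = f_pattern i k j l t r s"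
proof (cases r)
  case (Suc r')
  then show ?thesis using f_pattern_swap_pos[OF U] by simp
next
  case r: 0
  have U': "{i, k, j, l} = UNIV" "{i, l, j, k} = UNIV" "{i, l, k, j} = UNIV"
    "{i, j, l, k} = UNIV" using U by auto
  show ?thesis
  proof (cases s)
    case (Suc s')
    then show ?thesis using f_pattern_swap_pos[OF U'(1)] r by simp
  next
    case s: 0
    show ?thesis
    proof (cases t)
      case 0
      have "f_pattern i j k l 0 0 0 = f_pattern i k j l 0 0 0"
        using f_pattern_two_zero(1)[OF U, of 0] f_pattern_two_zero(1)[OF U'(1), of 0] e_pattern_swap[OF U, of 0 0 0]
        by (simp add: trace_0 sup_aci)
      then show ?thesis using 0 r s by simp
    next
      case (Suc t')
      have "f_pattern i j k l t 0 0 = f_pattern i l j k 0 t 0" using f_pattern_two_zero[OF U] by simp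
      also have "\<dots> = f_pattern i j l k 0 0 t" using f_pattern_swap_pos[OF U'(4)] Suc by simp
      also have "\<dots> = f_pattern i k l j 0 0 t" using f_pattern_reflect_pos[OF U'(4)] Suc by simp
      also have "\<dots> = f_pattern i l k j 0 t 0" using f_pattern_swap_pos[of i k l j] U' Suc by (simp add: insert_commute)
      also have "\<dots> = f_pattern i k j l t 0 0" using f_pattern_two_zero[OF U'(1)] by simp
      finally show ?thesis using r s by simp
    qed
  qed
qed

lemma f_pattern_reflect:
  assumes U: "{i, j, k, l} = (UNIV :: idx set)"
  shows "f_pattern i j k l t s r = f_pattern i l k j s t r"
proof (cases r)
  case (Suc r')
  then show ?thesis using f_pattern_reflect_pos[OF U] by simp
next
  case r: 0
  have U': "{i, k, j, l} = UNIV" "{i, l, j, k} = UNIV" "{i, l, k, j} = UNIV"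
    "{i, j, l, k} = UNIV" "{i, k, l, j} = UNIV" using U by auto
  have zero: "f_pattern i j k l t 0 0 = f_pattern i l k j 0 t 0" for t
    using f_pattern_swap[OF U, of t 0 0] f_pattern_two_zero[OF U'(1), of t] by simp
  have zero': "f_pattern i l k j s 0 0 = f_pattern i j k l 0 s 0"
    using f_pattern_swap[OF U'(3), of s 0 0] f_pattern_two_zero[OF U'(5), of s] by simp
  show ?thesis
  proof (cases "s = 0 \<or> t = 0")
    case True
    then show ?thesis using zero[of t] zero' r by auto
  next
    case False
    then obtain s' t' where st: "s = Suc s'" "t = Suc t'" by (meson not0_implies_Suc)
    have "f_pattern i j k l t s 0 = f_pattern i k j l t 0 s" by (rule f_pattern_swap[OF U])
    also have "\<dots> = f_pattern i l j k 0 t s" unfolding st by (rule f_pattern_reflect_pos[OF U'(1)])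
    also have "\<dots> = f_pattern i j l k 0 s t" by (rule f_pattern_swap[OF U'(2)])
    also have "\<dots> = f_pattern i k l j s 0 t" unfolding st by (rule f_pattern_reflect_pos[OF U'(4)])
    also have "\<dots> = f_pattern i l k j s t 0" by (rule f_pattern_swap[OF U'(5)])
    finally show ?thesis using r by simp
  qed
qed

text \<open>
  The form in which the pattern appears in the tabulated formulas and in \<open>factor\<close>: the terms \<open>u\<close> and \<open>v\<close>
  matter only through their traces below $e_i$, so the order of their upper indices is irrelevant.
\<close>

lemma f_pattern_pos:
  assumes U: "{i, j, k, l} = (UNIV :: idx set)"
    and u: "e i \<sqinter> u = trace i k l (Suc s)" and v: "e i \<sqinter> v = trace i l j r"
  shows "e_pattern i j k l t s (Suc r) \<sqinter> (trace i j k (Suc t) \<squnion> (u \<sqinter> v)) = f_pattern i j k l t s (Suc r)"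
proof -
  let ?E = "e_pattern i j k l t s (Suc r)"
  have "?E = ?E \<sqinter> trace i j k t" by (simp add: e_pattern_le inf_absorb1)
  moreover have "trace i j k t \<sqinter> (trace i j k (Suc t) \<squnion> (u \<sqinter> v)) = trace i j k (Suc t) \<squnion> (trace i j k t \<sqinter> (u \<sqinter> v))"
    using indices_distinct[OF U] by (intro modular_meet_join trace_antimono) auto
  moreover have "trace i j k t \<sqinter> (u \<sqinter> v) = trace i j k t \<sqinter> trace i k l (Suc s) \<sqinter> trace i l j r"
    unfolding u[symmetric] v[symmetric] by (simp add: trace_def inf_aci)
  ultimately have "?E \<sqinter> (trace i j k (Suc t) \<squnion> (u \<sqinter> v))
    = ?E \<sqinter> (trace i j k (Suc t) \<squnion> (trace i j k t \<sqinter> trace i k l (Suc s) \<sqinter> trace i l j r))"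
    by (metis inf_assoc inf_left_idem)
  then show ?thesis unfolding f_pattern_def using f_pattern_lower[OF U] by simp
qed

text \<open>
  Unless $t = s = r = 0$, one index is lowered in \<open>factor\<close>. The symmetry of the pattern allows it to be
  the last one, where \<open>f_pattern_pos\<close> applies.
\<close>

lemma f_pattern_factor:
  assumes U: "{i, j, k, l} = (UNIV :: idx set)"
  shows "e_pattern i j k l t s r \<sqinter> factor i j k l t s r = f_pattern i j k l t s r"
proof -
  note d = indices_distinct[OF U]
  have U': "{i, k, j, l} = UNIV" "{i, l, j, k} = UNIV" "{i, l, k, j} = UNIV"
    "{i, j, l, k} = UNIV" "{i, k, l, j} = UNIV" "{j, k, i, l} = UNIV" using U by auto
  have c: "e i \<sqinter> a j l n = trace i l j n" "e i \<sqinter> a k l n = trace i k l n" "e i \<sqinter> a j k n = trace i j k n"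
     "e i \<sqinter> a j l n = trace i j l n" "e i \<sqinter> a k l n = trace i l k n" "e i \<sqinter> a j k n = trace i k j n" for n
    using d trace_commute[of i j l n] trace_commute[of i k l n] trace_commute[of i j k n]
    by (simp_all add: trace_def)
  consider r' where "r = Suc r'" | s' where "r = 0" "s = Suc s'"
    | t' where "r = 0" "s = 0" "t = Suc t'" | "r = 0" "s = 0" "t = 0"
    by (metis not0_implies_Suc)
  then show ?thesis
  proof cases
    case 1
    then show ?thesis using f_pattern_pos[OF U c(2,1)] c(3) by (simp add: factor_def)
  next
    case 2
    have "f_pattern i j k l t s 0 = f_pattern i k j l t 0 s" by (rule f_pattern_swap[OF U])
    also have "\<dots> = e_pattern i k j l t 0 s \<sqinter> (trace i k j (Suc t) \<squnion> (a j l (Suc 0) \<sqinter> a k l s'))"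
      unfolding 2 using f_pattern_pos[OF U'(1) c(4,5)] by simp
    finally show ?thesis using 2 by (simp add: factor_def c(6) e_pattern_swap[OF U])
  next
    case 3
    have "f_pattern i j k l t 0 0 = f_pattern i l k j 0 t 0" by (rule f_pattern_reflect[OF U])
    also have "\<dots> = f_pattern i k l j 0 0 t" by (rule f_pattern_swap[OF U'(3)])
    also have "\<dots> = e_pattern i k l j 0 0 t \<sqinter> (trace i k l (Suc 0) \<squnion> (a j l (Suc 0) \<sqinter> a j k t'))"
      unfolding 3 using f_pattern_pos[OF U'(5) c(1,3)] by simp
    also have "e_pattern i k l j 0 0 t = e_pattern i j k l t 0 0" by (simp add: e_pattern_def trace_0 inf_aci)
    finally show ?thesis using 3 by (simp add: factor_def c(2))
  next
    case 4
    then show ?thesis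
      using f_pattern_two_zero(1)[OF U, of 0] by (simp add: factor_def trace_0 sup_aci)
  qed
qed

text \<open>
  By \<open>trace_of_join\<close> the pair of indices $(p + 2, q)$ gives traces with the indices $p + 1, q + 1$, where
  the first index has been lowered; the pair $(p, q + 2)$ gives the same traces, where the second index
  has been lowered. So only $p + q$ and the parity of $p$ matter.
\<close>

lemma trace_of_join_shift:
  assumes U: "{i, j, k, l} = (UNIV :: idx set)"
  shows "trace i j k t \<sqinter> (a j k (Suc t) \<squnion> (e l \<sqinter> a i j (p + 2 * n) \<sqinter> a i k q))
    = trace i j k t \<sqinter> (a j k (Suc t) \<squnion> (e l \<sqinter> a i j p \<sqinter> a i k (q + 2 * n)))"
proof (induction n arbitrary: p q)
  case (Suc n)
  note d = indices_distinct[OF U]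
  have U': "{i, k, j, l} = UNIV" using U by auto
  have c: "trace i l k m = trace i k l m" "trace i k j m = trace i j k m" "trace i l j m = trace i j l m" for m
    using d by (simp_all add: trace_commute)
  let ?X = "\<lambda>p q. trace i j k t \<sqinter> (a j k (Suc t) \<squnion> (e l \<sqinter> a i j p \<sqinter> a i k q))"
  have step: "?X (Suc (Suc p)) q = ?X p (Suc (Suc q))" for p q
  proof -
    have "?X (Suc (Suc p)) q = trace i k j t \<sqinter> (a j k (Suc t) \<squnion> (e l \<sqinter> a i k q \<sqinter> a i j (Suc (Suc p))))"
      by (simp add: c inf_aci)
    also have "\<dots> = trace i k j (Suc t) \<squnion> (trace i k j t \<sqinter> trace i j l (Suc q) \<sqinter> trace i l k (Suc p))"
      by (rule trace_of_join[OF U']) simp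
    also have "\<dots> = trace i j k (Suc t) \<squnion> (trace i j k t \<sqinter> trace i k l (Suc p) \<sqinter> trace i l j (Suc q))"
      by (simp add: c inf_aci)
    also have "\<dots> = ?X p (Suc (Suc q))"
      by (rule trace_of_join[OF U, symmetric]) simp
    finally show ?thesis .
  qed
  have "?X (p + 2 * Suc n) q = ?X (p + 2 * n) (Suc (Suc q))" using step[of "p + 2 * n"] by simp
  also have "\<dots> = ?X p (Suc (Suc q) + 2 * n)" by (rule Suc.IH)
  finally show ?case by simp
qed simp

text \<open>
  Here \<open>s\<close> and \<open>r\<close> have changed places compared with \<open>f_pattern_def\<close>. The tabulated formulas of the types
  \<open>F2\<close>, \<open>F3\<close>, \<open>F4\<close> and \<open>G1\<close> have the indices in this order; there both are even.
\<close>

lemma f_pattern_mixed: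
  assumes U: "{i, j, k, l} = (UNIV :: idx set)" and parity: "even s = even r"
  shows "e_pattern i j k l t s r \<sqinter> (a j k (Suc t) \<squnion> (e l \<sqinter> a i j r \<sqinter> a i k s)) = f_pattern i j k l t s r"
proof -
  let ?E = "e_pattern i j k l t s r"
  have E: "?E = ?E \<sqinter> trace i j k t" by (simp add: e_pattern_le inf_absorb1)
  have "trace i j k t \<sqinter> (a j k (Suc t) \<squnion> (e l \<sqinter> a i j r \<sqinter> a i k s))
    = trace i j k t \<sqinter> (a j k (Suc t) \<squnion> (e l \<sqinter> a i j s \<sqinter> a i k r))"
  proof (cases "s \<le> r")
    case True
    then have "even (r - s)" using parity by simp
    then obtain n where "r = s + 2 * n" using True by (metis dvdE le_add_diff_inverse)
    then show ?thesis using trace_of_join_shift[OF U, of t s n s] by simp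
  next
    case False
    then have "even (s - r)" using parity by simp
    then obtain n where "s = r + 2 * n" using False by (metis dvdE le_add_diff_inverse nat_le_linear)
    then show ?thesis using trace_of_join_shift[OF U, of t r n r] by simp
  qed
  then show ?thesis unfolding f_pattern_def by (metis E inf_assoc)
qed

section \<open>The tabulated elements\<close>

lemma meet_traces:
  "e i \<sqinter> a u v l \<sqinter> a u' v' m \<sqinter> a u'' v'' n = trace i u v l \<sqinter> trace i u' v' m \<sqinter> trace i u'' v'' n"
  by (simp add: trace_def inf_aci)

text \<open>
  One calculation for \<open>F2\<close>, \<open>F3\<close> and \<open>F4\<close>, where \<open>i\<close> is the end and \<open>l\<close> the start. The table writes the
  last atomic element in either order, hence the two forms of $e_\<alpha>$.
\<close>

lemma F_value:
  assumes U: "{i, j, k, l} = (UNIV :: idx set)" and t: "1 \<le> t"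
  shows "e i \<sqinter> a k l (2*s) \<sqinter> a j l (2*r) \<sqinter> a k j (2*t-1) = e_pattern i j k l (2*t-1) (2*s) (2*r)"
    and "e i \<sqinter> a k l (2*s) \<sqinter> a j l (2*r) \<sqinter> a j k (2*t-1) = e_pattern i j k l (2*t-1) (2*s) (2*r)"
    and "e_pattern i j k l (2*t-1) (2*s) (2*r) \<sqinter> (a j k (2*t) \<squnion> (e l \<sqinter> a i j (2*r) \<sqinter> a i k (2*s)))
      = f_pattern i j k l (2*t-1) (2*s) (2*r)"
proof -
  show "e i \<sqinter> a k l (2*s) \<sqinter> a j l (2*r) \<sqinter> a k j (2*t-1) = e_pattern i j k l (2*t-1) (2*s) (2*r)"
    "e i \<sqinter> a k l (2*s) \<sqinter> a j l (2*r) \<sqinter> a j k (2*t-1) = e_pattern i j k l (2*t-1) (2*s) (2*r)"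
    unfolding meet_traces e_pattern_def using indices_distinct[OF U]
    by (simp_all add: trace_commute[of i k j] trace_commute[of i l j] inf_aci)
  have "Suc (2*t-1) = 2*t" using t by simp
  then show "e_pattern i j k l (2*t-1) (2*s) (2*r) \<sqinter> (a j k (2*t) \<squnion> (e l \<sqinter> a i j (2*r) \<sqinter> a i k (2*s)))
      = f_pattern i j k l (2*t-1) (2*s) (2*r)"
    using f_pattern_mixed[OF U, of "2*s" "2*r" "2*t-1"] by simp
qed

lemma G1_value:
  assumes U: "{i, j, k, l} = (UNIV :: idx set)"
  shows "e i \<sqinter> a k l (2*s) \<sqinter> a j l (2*t) \<sqinter> a j k (2*r) = e_pattern i j k l (2*r) (2*s) (2*t)"
    and "e_pattern i j k l (2*r) (2*s) (2*t) \<sqinter> (a j k (2*r+1) \<squnion> (e l \<sqinter> a k i (2*s) \<sqinter> a j i (2*t)))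
      = f_pattern i j k l (2*r) (2*s) (2*t)"
proof -
  note d = indices_distinct[OF U]
  show "e i \<sqinter> a k l (2*s) \<sqinter> a j l (2*t) \<sqinter> a j k (2*r) = e_pattern i j k l (2*r) (2*s) (2*t)"
    unfolding meet_traces e_pattern_def using d
    by (simp add: trace_commute[of i l j] inf_aci)
  have "e l \<sqinter> a k i (2*s) \<sqinter> a j i (2*t) = trace l k i (2*s) \<sqinter> trace l j i (2*t)"
    by (simp add: trace_def inf_aci)
  also have "\<dots> = trace l i k (2*s) \<sqinter> trace l i j (2*t)"
    using d by (simp add: trace_commute[of l i])
  also have "\<dots> = e l \<sqinter> a i j (2*t) \<sqinter> a i k (2*s)"
    by (simp add: trace_def inf_aci)
  finally show "e_pattern i j k l (2*r) (2*s) (2*t) \<sqinter> (a j k (2*r+1) \<squnion> (e l \<sqinter> a k i (2*s) \<sqinter> a j i (2*t)))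
      = f_pattern i j k l (2*r) (2*s) (2*t)"
    using f_pattern_mixed[OF U, of "2*s" "2*t" "2*r"] by simp
qed

text \<open>
  For \<open>G2\<close> and \<open>G3\<close>, with start \<open>k\<close>. For $t = 0$ the index lowered is that of $a^{lk}$ instead of
  that of $a^{lj}$, and the two exchange their roles in \<open>f_pattern_pos\<close>.
\<close>

lemma G2_value:
  assumes U: "{i, j, k, l} = (UNIV :: idx set)" and r: "1 \<le> r"
  shows "e i \<sqinter> a l j (2*t) \<sqinter> a l k (2*s+1) \<sqinter> a k j (2*r-1) = e_pattern i j k l (2*r-1) (2*s+1) (2*t)"
    and "e_pattern i j k l (2*r-1) (2*s+1) (2*t) \<sqinter> ((e i \<sqinter> a k j (2*r)) \<squnion>
        (if 1 \<le> t then a l k (2*s+2) \<sqinter> a l j (2*t-1) else a l k (2*s) \<sqinter> a l j (2*t+1)))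
      = f_pattern i j k l (2*r-1) (2*s+1) (2*t)"
proof -
  note d = indices_distinct[OF U]
  have U': "{i, k, j, l} = UNIV" using U by auto
  obtain r' where r': "r = Suc r'" using r by (cases r) auto
  have c: "e i \<sqinter> a l k n = trace i k l n" "e i \<sqinter> a k j n = trace i j k n" "e i \<sqinter> a l j n = trace i l j n"
      "e i \<sqinter> a l j n = trace i j l n" "e i \<sqinter> a l k n = trace i l k n" "e i \<sqinter> a k j n = trace i k j n" for n
    using d trace_commute[of i k l n] trace_commute[of i j k n] trace_commute[of i l j n]
    by (simp_all add: trace_def)
  show "e i \<sqinter> a l j (2*t) \<sqinter> a l k (2*s+1) \<sqinter> a k j (2*r-1) = e_pattern i j k l (2*r-1) (2*s+1) (2*t)"
    unfolding meet_traces e_pattern_def using d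
    by (simp add: trace_commute[of i k j] trace_commute[of i l k] inf_aci)
  show "e_pattern i j k l (2*r-1) (2*s+1) (2*t) \<sqinter> ((e i \<sqinter> a k j (2*r)) \<squnion>
        (if 1 \<le> t then a l k (2*s+2) \<sqinter> a l j (2*t-1) else a l k (2*s) \<sqinter> a l j (2*t+1)))
      = f_pattern i j k l (2*r-1) (2*s+1) (2*t)"
  proof (cases t)
    case 0
    have "e_pattern i k j l (2*r-1) 0 (Suc (2*s)) \<sqinter> (trace i k j (Suc (2*r-1)) \<squnion> (a l j (Suc 0) \<sqinter> a l k (2*s)))
      = f_pattern i k j l (2*r-1) 0 (Suc (2*s))"
      by (rule f_pattern_pos[OF U' c(4) c(5)])
    then show ?thesis
      using 0 r' by (simp add: c(6) e_pattern_swap[OF U] f_pattern_swap[OF U] inf_commute)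
  next
    case (Suc t')
    have "e_pattern i j k l (2*r-1) (2*s+1) (Suc (2*t-1)) \<sqinter>
        (trace i j k (Suc (2*r-1)) \<squnion> (a l k (Suc (2*s+1)) \<sqinter> a l j (2*t-1)))
      = f_pattern i j k l (2*r-1) (2*s+1) (Suc (2*t-1))"
      by (rule f_pattern_pos[OF U c(1) c(3)])
    then show ?thesis using Suc r' by (simp add: c(2))
  qed
qed

lemma G4_value:
  assumes U: "{i, j, k, l} = (UNIV :: idx set)" and t: "1 \<le> t"
  shows "e i \<sqinter> a l k (2*r) \<sqinter> a l j (2*s+1) \<sqinter> a j k (2*t-1) = e_pattern i j k l (2*t-1) (2*r) (2*s+1)"
    and "e_pattern i j k l (2*t-1) (2*r) (2*s+1) \<sqinter> ((e i \<sqinter> a j k (2*t)) \<squnion> (a l j (2*s) \<sqinter> a l k (2*r+1)))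
      = f_pattern i j k l (2*t-1) (2*r) (2*s+1)"
proof -
  note d = indices_distinct[OF U]
  obtain t' where t': "t = Suc t'" using t by (cases t) auto
  have c: "e i \<sqinter> a l k n = trace i k l n" "e i \<sqinter> a l j n = trace i l j n" for n
    using d trace_commute[of i k l n] by (simp_all add: trace_def)
  show "e i \<sqinter> a l k (2*r) \<sqinter> a l j (2*s+1) \<sqinter> a j k (2*t-1) = e_pattern i j k l (2*t-1) (2*r) (2*s+1)"
    unfolding meet_traces e_pattern_def using d by (simp add: trace_commute[of i l k] inf_aci)
  show "e_pattern i j k l (2*t-1) (2*r) (2*s+1) \<sqinter> ((e i \<sqinter> a j k (2*t)) \<squnion> (a l j (2*s) \<sqinter> a l k (2*r+1)))
      = f_pattern i j k l (2*t-1) (2*r) (2*s+1)"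
    using f_pattern_pos[OF U c(1)[of "Suc (2*r)"] c(2)[of "2*s"], of "2*t-1"] t'
    by (simp add: inf_commute trace_def)
qed

lemma H1_value:
  assumes U: "{i, j, k, l} = (UNIV :: idx set)" and r: "1 \<le> r" and s: "1 \<le> s"
  shows "e i \<sqinter> a k j (2*r-1) \<sqinter> a k l (2*s-1) \<sqinter> a j l (2*t+1) = e_pattern i j k l (2*r-1) (2*s-1) (2*t+1)"
    and "e_pattern i j k l (2*r-1) (2*s-1) (2*t+1) \<sqinter> ((e i \<sqinter> a k j (2*r)) \<squnion> (a k l (2*s) \<sqinter> a j l (2*t)))
      = f_pattern i j k l (2*r-1) (2*s-1) (2*t+1)"
proof -
  note d = indices_distinct[OF U]
  obtain r' s' where rs: "r = Suc r'" "s = Suc s'" using r s by (cases r; cases s) auto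
  have c: "e i \<sqinter> a k l n = trace i k l n" "e i \<sqinter> a j l n = trace i l j n" "e i \<sqinter> a k j n = trace i j k n" for n
    using d trace_commute[of i l j n] trace_commute[of i j k n] by (simp_all add: trace_def)
  show "e i \<sqinter> a k j (2*r-1) \<sqinter> a k l (2*s-1) \<sqinter> a j l (2*t+1) = e_pattern i j k l (2*r-1) (2*s-1) (2*t+1)"
    unfolding meet_traces e_pattern_def using d
    by (simp add: trace_commute[of i k j] trace_commute[of i l j] inf_aci)
  show "e_pattern i j k l (2*r-1) (2*s-1) (2*t+1) \<sqinter> ((e i \<sqinter> a k j (2*r)) \<squnion> (a k l (2*s) \<sqinter> a j l (2*t)))
      = f_pattern i j k l (2*r-1) (2*s-1) (2*t+1)"
    using f_pattern_pos[OF U c(1)[of "Suc (2*s-1)"] c(2)[of "2*t"], of "2*r-1"] by (simp add: c(3) rs)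
qed

section \<open>Sequences with a given end\<close>

lemma pw_0 [simp]: "pw p q 0 = []" by (simp add: pw_def)
lemma pw_Suc: "pw p q (Suc n) = p # q # pw p q n" by (simp add: pw_def)
lemma pw_eq_Nil [simp]: "pw p q n = [] \<longleftrightarrow> n = 0" by (cases n) (simp_all add: pw_Suc)
lemma hd_pw [simp]: "0 < n \<Longrightarrow> hd (pw p q n) = p" by (cases n) (simp_all add: pw_Suc)
lemma last_pw [simp]: "0 < n \<Longrightarrow> last (pw p q n) = q"
  by (induction n) (auto simp: pw_Suc)
lemma distinct_adj_pw: "p \<noteq> q \<Longrightarrow> distinct_adj (pw p q n)"
proof (induction n)
  case (Suc n)
  then show ?case by (cases n) (auto simp: pw_Suc)
qed simp

lemma row_valuesI:
  "{i, j, k, l} = UNIV \<Longrightarrow> hd \<beta> = i \<Longrightarrow> x = e_pattern i j k l t s r \<Longrightarrow> y = f_pattern i j k l t s r \<Longrightarrow>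
  \<exists>j k l t s r. {hd \<beta>, j, k, l} = UNIV \<and> x = e_pattern (hd \<beta>) j k l t s r \<and> y = f_pattern (hd \<beta>) j k l t s r"
  by blast

lemma row_values:
  assumes "row p1 p2 p3 p4 \<beta> x y" and U: "{p1, p2, p3, p4} = (UNIV :: idx set)"
  shows "\<exists>j k l t s r. {hd \<beta>, j, k, l} = UNIV \<and> x = e_pattern (hd \<beta>) j k l t s r \<and> y = f_pattern (hd \<beta>) j k l t s r"
proof -
  have V: "{p2, p4, p3, p1} = UNIV" "{p3, p4, p2, p1} = UNIV" "{p4, p3, p2, p1} = UNIV" "{p1, p3, p2, p4} = UNIV"
   "{p2, p4, p1, p3} = UNIV" "{p3, p4, p1, p2} = UNIV" "{p4, p1, p2, p3} = UNIV" using U by auto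
  show ?thesis using assms(1)
  proof cases
    case (F2 t s r)
    show ?thesis unfolding F2(2) F_value(1,3)[OF V(1) F2(3)] F2(4)
      by (rule row_valuesI[OF V(1)]) (use F2 in \<open>auto simp: hd_append\<close>)
  next
    case (F3 s t r)
    show ?thesis unfolding F3(2) F_value(1,3)[OF V(2) F3(3)] F3(4)
      by (rule row_valuesI[OF V(2)]) (use F3 in \<open>auto simp: hd_append\<close>)
  next
    case (F4 r t s)
    show ?thesis unfolding F4(2) F_value(2,3)[OF V(3) F4(3)] F4(4)
      by (rule row_valuesI[OF V(3)]) (use F4 in \<open>auto simp: hd_append\<close>)
  next
    case (G1 s t r)
    show ?thesis unfolding G1(2) G1_value[OF V(4)] G1(3)
      by (rule row_valuesI[OF V(4)]) (use G1 in \<open>auto simp: hd_append\<close>)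
  next
    case (G2 r t s)
    show ?thesis unfolding G2(2) G2_value[OF V(5) G2(3)] G2(4)
      by (rule row_valuesI[OF V(5)]) (use G2 in \<open>auto simp: hd_append\<close>)
  next
    case (G3 r s t)
    show ?thesis unfolding G3(2) G2_value[OF V(6) G3(3)] G3(4)
      by (rule row_valuesI[OF V(6)]) (use G3 in \<open>auto simp: hd_append\<close>)
  next
    case (G4 t r s)
    show ?thesis unfolding G4(2) G4_value[OF V(7) G4(3)] G4(4)
      by (rule row_valuesI[OF V(7)]) (use G4 in \<open>auto simp: hd_append\<close>)
  next
    case (H1 r s t)
    show ?thesis unfolding H1(2) H1_value[OF V(4) H1(3,4)] H1(5)
      by (rule row_valuesI[OF V(4)]) (use H1 in \<open>auto simp: hd_append\<close>)
  qed
qed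


lemma row_at_obtain:
  obtains p2 p3 p4 where "{m, p2, p3, p4} = UNIV" "row_at m = row m p2 p3 p4"
proof -
  let ?\<tau> = "id(n1 := m, m := n1)"
  have "row_at m = row m (?\<tau> n2) (?\<tau> n3) (?\<tau> n4)"
    by (simp add: row_at_def Let_def)
  moreover have "{m, ?\<tau> n2, ?\<tau> n3, ?\<tau> n4} = UNIV"
    unfolding UNIV_idx by (cases m) auto
  ultimately show ?thesis using that by blast
qed

lemma replace_hd: "replace \<alpha> \<beta> \<Longrightarrow> hd \<alpha> = hd \<beta>"
  by (induction rule: replace.induct) (simp add: hd_append)

lemma same_seq_hd: "same_seq \<alpha> \<beta> \<Longrightarrow> hd \<alpha> = hd \<beta>"
  unfolding same_seq_def by (induction rule: rtranclp_induct) (auto dest: replace_hd)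

definition tabulated :: "idx \<Rightarrow> D4 \<Rightarrow> D4 \<Rightarrow> bool" where
  "tabulated i x y \<longleftrightarrow> (\<exists>m \<alpha> \<beta>. hd \<alpha> = i \<and> admissible \<alpha> \<and> same_seq \<alpha> \<beta> \<and> row_at m \<beta> x y)"

lemma tabulatedI:
  assumes "row m p2 p3 p4 \<beta> x y" "row_at m = row m p2 p3 p4" "admissible \<beta>" "hd \<beta> = i"
  shows "tabulated i x y"
  using assms unfolding tabulated_def same_seq_def by (metis rtranclp.rtrancl_refl)

lemma odd_Suc_double: "odd n \<Longrightarrow> \<exists>h\<ge>1. n = 2 * h - (1::nat)"
  by (elim oddE) (rule_tac x = "Suc b" in exI, simp)

lemma odd_even_even:
  fixes P :: "nat \<Rightarrow> nat \<Rightarrow> nat \<Rightarrow> bool"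
  assumes "\<And>t s r. 1 \<le> t \<Longrightarrow> P (2*t-1) (2*s) (2*r)"
  shows "\<forall>t s r. odd t \<and> even s \<and> even r \<longrightarrow> P t s r"
proof (intro allI impI, elim conjE evenE)
  fix t s r h h' :: nat
  assume "odd t" "s = 2 * h" "r = 2 * h'"
  then show "P t s r" using assms odd_Suc_double[of t] by blast
qed

lemma odd_odd_even:
  fixes P :: "nat \<Rightarrow> nat \<Rightarrow> nat \<Rightarrow> bool"
  assumes "\<And>t s r. 1 \<le> t \<Longrightarrow> P (2*t-1) (2*s+1) (2*r)"
  shows "\<forall>t s r. odd t \<and> odd s \<and> even r \<longrightarrow> P t s r"
proof (intro allI impI, elim conjE)
  fix t s r :: nat
  assume "odd t" "odd s" "even r"
  moreover from \<open>odd s\<close> obtain h where "s = 2 * h + 1" by (rule oddE)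
  moreover from \<open>even r\<close> obtain h' where "r = 2 * h'" by (rule evenE)
  ultimately show "P t s r" using assms odd_Suc_double[of t] by blast
qed

lemmas admissible_simps = admissible_def distinct_adj_append_iff distinct_adj_pw hd_append last_append
  distinct_adj_Cons

text \<open>
  The parities of the three indices determine the type and the start \<open>m\<close> of the sequence. In this and
  the next lemma \<open>m\<close> is the index complementary to the pair whose parity differs from that of the
  other two, and the type depends on which of \<open>p2\<close>, \<open>p3\<close>, \<open>p4\<close> is the end.
\<close>

lemma tabulated_one_odd:
  assumes U: "{i, j, k, m} = (UNIV :: idx set)"
  shows "\<exists>j k. {i, j, k, m} = UNIV \<and>
    (\<forall>t s r. odd t \<and> even s \<and> even r \<longrightarrow> tabulated i (e_pattern i j k m t s r) (f_pattern i j k m t s r))"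
proof -
  obtain p2 p3 p4 where m: "row_at m = row m p2 p3 p4" and P: "{m, p2, p3, p4} = UNIV"
    by (rule row_at_obtain)
  note d = indices_distinct[OF P]
  have V: "{p2, p4, p3, m} = UNIV" "{p3, p4, p2, m} = UNIV" "{p4, p3, p2, m} = UNIV" using P by auto
  have 2: "tabulated p2 (e_pattern p2 p4 p3 m (2*t-1) (2*s) (2*r)) (f_pattern p2 p4 p3 m (2*t-1) (2*s) (2*r))"
    if "1 \<le> t" for t s r
    using row.F2[OF that F_value(1)[OF V(1) that, symmetric]] unfolding F_value(3)[OF V(1) that]
    by (rule tabulatedI[OF _ m]) (use d that in \<open>auto simp: admissible_simps\<close>)
  have 3: "tabulated p3 (e_pattern p3 p4 p2 m (2*t-1) (2*s) (2*r)) (f_pattern p3 p4 p2 m (2*t-1) (2*s) (2*r))"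
    if "1 \<le> t" for t s r
    using row.F3[OF that F_value(1)[OF V(2) that, symmetric]] unfolding F_value(3)[OF V(2) that]
    by (rule tabulatedI[OF _ m]) (use d that in \<open>auto simp: admissible_simps\<close>)
  have 4: "tabulated p4 (e_pattern p4 p3 p2 m (2*t-1) (2*s) (2*r)) (f_pattern p4 p3 p2 m (2*t-1) (2*s) (2*r))"
    if "1 \<le> t" for t s r
    using row.F4[OF that F_value(2)[OF V(3) that, symmetric]] unfolding F_value(3)[OF V(3) that]
    by (rule tabulatedI[OF _ m]) (use d that in \<open>auto simp: admissible_simps\<close>)
  have "i \<noteq> m" using indices_distinct[OF U] by simp
  then have "i = p2 \<or> i = p3 \<or> i = p4" using P by blast
  then show ?thesis
    using V odd_even_even[of "\<lambda>t s r. tabulated p2 (e_pattern p2 p4 p3 m t s r) (f_pattern p2 p4 p3 m t s r)", OF 2]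
      odd_even_even[of "\<lambda>t s r. tabulated p3 (e_pattern p3 p4 p2 m t s r) (f_pattern p3 p4 p2 m t s r)", OF 3]
      odd_even_even[of "\<lambda>t s r. tabulated p4 (e_pattern p4 p3 p2 m t s r) (f_pattern p4 p3 p2 m t s r)", OF 4]
    by blast
qed

lemma tabulated_two_odd:
  assumes U: "{i, j, k, m} = (UNIV :: idx set)"
  shows "\<exists>j k. {i, j, m, k} = UNIV \<and>
    (\<forall>t s r. odd t \<and> odd s \<and> even r \<longrightarrow> tabulated i (e_pattern i j m k t s r) (f_pattern i j m k t s r))"
proof -
  obtain p2 p3 p4 where m: "row_at m = row m p2 p3 p4" and P: "{m, p2, p3, p4} = UNIV"
    by (rule row_at_obtain)
  note d = indices_distinct[OF P]
  have V: "{p2, p4, m, p3} = UNIV" "{p3, p4, m, p2} = UNIV" "{p4, m, p2, p3} = UNIV" "{p4, p2, m, p3} = UNIV"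
    using P by auto
  have 2: "tabulated p2 (e_pattern p2 p4 m p3 (2*r-1) (2*s+1) (2*t)) (f_pattern p2 p4 m p3 (2*r-1) (2*s+1) (2*t))"
    if "1 \<le> r" for t s r
    using row.G2[OF that G2_value(1)[OF V(1) that, symmetric]] unfolding G2_value(2)[OF V(1) that]
    by (rule tabulatedI[OF _ m]) (use d that in \<open>auto simp: admissible_simps\<close>)
  have 3: "tabulated p3 (e_pattern p3 p4 m p2 (2*r-1) (2*s+1) (2*t)) (f_pattern p3 p4 m p2 (2*r-1) (2*s+1) (2*t))"
    if "1 \<le> r" for t s r
    using row.G3[OF that G2_value(1)[OF V(2) that, symmetric]] unfolding G2_value(2)[OF V(2) that]
    by (rule tabulatedI[OF _ m]) (use d that in \<open>auto simp: admissible_simps\<close>)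
  have "tabulated p4 (e_pattern p4 m p2 p3 (2*r-1) (2*t) (2*s+1)) (f_pattern p4 m p2 p3 (2*r-1) (2*t) (2*s+1))"
    if "1 \<le> r" for t s r
    using row.G4[OF that G4_value(1)[OF V(3) that, symmetric]] unfolding G4_value(2)[OF V(3) that]
    by (rule tabulatedI[OF _ m]) (use d that in \<open>auto simp: admissible_simps\<close>)
  then have 4: "tabulated p4 (e_pattern p4 p2 m p3 (2*r-1) (2*s+1) (2*t)) (f_pattern p4 p2 m p3 (2*r-1) (2*s+1) (2*t))"
    if "1 \<le> r" for t s r
    using that by (simp only: e_pattern_swap[OF V(4)] f_pattern_swap[OF V(4)])
  have "i \<noteq> m" using indices_distinct[OF U] by simp
  then have "i = p2 \<or> i = p3 \<or> i = p4" using P by blast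
  then show ?thesis
    using V odd_odd_even[of "\<lambda>t s r. tabulated p2 (e_pattern p2 p4 m p3 t s r) (f_pattern p2 p4 m p3 t s r)", OF 2]
      odd_odd_even[of "\<lambda>t s r. tabulated p3 (e_pattern p3 p4 m p2 t s r) (f_pattern p3 p4 m p2 t s r)", OF 3]
      odd_odd_even[of "\<lambda>t s r. tabulated p4 (e_pattern p4 p2 m p3 t s r) (f_pattern p4 p2 m p3 t s r)", OF 4]
    by blast
qed

lemma tabulated_all_even:
  "\<exists>j k l. {i, j, k, l} = (UNIV :: idx set) \<and>
    (\<forall>t s r. even t \<and> even s \<and> even r \<longrightarrow> tabulated i (e_pattern i j k l t s r) (f_pattern i j k l t s r))"
proof -
  obtain p2 p3 p4 where m: "row_at i = row i p2 p3 p4" and P: "{i, p2, p3, p4} = UNIV"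
    by (rule row_at_obtain)
  note d = indices_distinct[OF P]
  have V: "{i, p3, p2, p4} = UNIV" using P by auto
  have "tabulated i (e_pattern i p3 p2 p4 (2*r) (2*s) (2*t)) (f_pattern i p3 p2 p4 (2*r) (2*s) (2*t))" for t s r
    using row.G1[OF G1_value(1)[OF V, symmetric]] unfolding G1_value(2)[OF V]
    by (rule tabulatedI[OF _ m]) (use d in \<open>auto simp: admissible_simps\<close>)
  then show ?thesis using V by (metis evenE)
qed

lemma tabulated_all_odd:
  "\<exists>j k l. {i, j, k, l} = (UNIV :: idx set) \<and>
    (\<forall>t s r. odd t \<and> odd s \<and> odd r \<longrightarrow> tabulated i (e_pattern i j k l t s r) (f_pattern i j k l t s r))"
proof -
  obtain p2 p3 p4 where m: "row_at i = row i p2 p3 p4" and P: "{i, p2, p3, p4} = UNIV"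
    by (rule row_at_obtain)
  note d = indices_distinct[OF P]
  have V: "{i, p3, p2, p4} = UNIV" using P by auto
  have "tabulated i (e_pattern i p3 p2 p4 (2*r-1) (2*s-1) (2*t+1)) (f_pattern i p3 p2 p4 (2*r-1) (2*s-1) (2*t+1))"
    if "1 \<le> r" "1 \<le> s" for t s r
    using row.H1[OF that H1_value(1)[OF V that, symmetric]] unfolding H1_value(2)[OF V that]
    by (rule tabulatedI[OF _ m]) (use d that in \<open>auto simp: admissible_simps\<close>)
  then show ?thesis using V by (metis odd_Suc_double oddE)
qed

lemma arrangements:
  assumes U: "{i, j, k, l} = (UNIV :: idx set)" and U': "{i, j', k', l'} = (UNIV :: idx set)"
  obtains "j' = j" "k' = k" "l' = l" | "j' = j" "k' = l" "l' = k" | "j' = k" "k' = j" "l' = l"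
    | "j' = k" "k' = l" "l' = j" | "j' = l" "k' = j" "l' = k" | "j' = l" "k' = k" "l' = j"
proof -
  have "j' \<in> {j, k, l}" "k' \<in> {j, k, l}" "l' \<in> {j, k, l}"
    using U indices_distinct[OF U'] by blast+
  then show ?thesis using that indices_distinct[OF U'] by blast
qed

text \<open>
  Attaching each lower index to the index complementary to its pair, as a function \<open>n\<close>, expresses that the
  patterns depend on \<open>i\<close> and on the three indexed pairs only, not on the naming of \<open>j\<close>, \<open>k\<close>, \<open>l\<close>.
\<close>

lemma patterns_arrangement:
  assumes U: "{i, j, k, l} = (UNIV :: idx set)" and U': "{i, j', k', l'} = (UNIV :: idx set)"
  shows "e_pattern i j' k' l' (n l') (n j') (n k') = e_pattern i j k l (n l) (n j) (n k)"
    and "f_pattern i j' k' l' (n l') (n j') (n k') = f_pattern i j k l (n l) (n j) (n k)"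
proof -
  have V: "{i, k, j, l} = UNIV" "{i, l, k, j} = UNIV" "{i, k, l, j} = UNIV" "{i, l, j, k} = UNIV"
    "{i, j, l, k} = UNIV" using U by auto
  have "e_pattern i j' k' l' (n l') (n j') (n k') = e_pattern i j k l (n l) (n j) (n k) \<and>
     f_pattern i j' k' l' (n l') (n j') (n k') = f_pattern i j k l (n l) (n j) (n k)"
    using U U'
  proof (cases rule: arrangements)
    case 2
    then show ?thesis using e_pattern_swap[OF U] e_pattern_reflect[OF V(1)] e_pattern_swap[OF V(4)]
       f_pattern_swap[OF U] f_pattern_reflect[OF V(1)] f_pattern_swap[OF V(4)] by metis
  next
    case 3
    then show ?thesis using e_pattern_swap[OF U] f_pattern_swap[OF U] by metis
  next
    case 4
    then show ?thesis using e_pattern_swap[OF V(2)] e_pattern_reflect[OF U] f_pattern_swap[OF V(2)] f_pattern_reflect[OF U] by metis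
  next
    case 5
    then show ?thesis using e_pattern_swap[OF U] e_pattern_reflect[OF V(1)] f_pattern_swap[OF U] f_pattern_reflect[OF V(1)] by metis
  next
    case 6
    then show ?thesis using e_pattern_reflect[OF U] f_pattern_reflect[OF U] by metis
  qed simp
  then show "e_pattern i j' k' l' (n l') (n j') (n k') = e_pattern i j k l (n l) (n j) (n k)"
    and "f_pattern i j' k' l' (n l') (n j') (n k') = f_pattern i j k l (n l) (n j) (n k)" by auto
qed

lemma tabulated_pattern:
  assumes U: "{i, j, k, l} = (UNIV :: idx set)"
  shows "tabulated i (e_pattern i j k l (n l) (n j) (n k)) (f_pattern i j k l (n l) (n j) (n k))"
proof -
  have by_arrangement: ?thesis if "{i, j', k', l'} = UNIV"
    "tabulated i (e_pattern i j' k' l' (n l') (n j') (n k')) (f_pattern i j' k' l' (n l') (n j') (n k'))" for j' k' l'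
    using that patterns_arrangement[OF U that(1)] by metis
  note d = indices_distinct[OF U]
  have other: "x = i \<or> x = j \<or> x = k \<or> x = l" for x using U by blast
  have others: "\<exists>x y. {i, x, y, m} = UNIV" if "m \<noteq> i" for m
  proof -
    have "{i, k, l, j} = UNIV" "{i, j, l, k} = UNIV" using U by auto
    then show ?thesis using U other[of m] that by metis
  qed
  consider "\<forall>x. x \<noteq> i \<longrightarrow> even (n x)" | "\<forall>x. x \<noteq> i \<longrightarrow> odd (n x)"
    | m where "m \<noteq> i" "odd (n m)" "\<forall>x. x \<noteq> i \<and> x \<noteq> m \<longrightarrow> even (n x)"
    | m where "m \<noteq> i" "even (n m)" "\<forall>x. x \<noteq> i \<and> x \<noteq> m \<longrightarrow> odd (n x)"
  proof -
    have "(\<forall>x. x \<noteq> i \<longrightarrow> P x) \<longleftrightarrow> P j \<and> P k \<and> P l"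
      "(\<forall>x. x \<noteq> i \<and> x \<noteq> j \<longrightarrow> P x) \<longleftrightarrow> P k \<and> P l"
      "(\<forall>x. x \<noteq> i \<and> x \<noteq> k \<longrightarrow> P x) \<longleftrightarrow> P j \<and> P l"
      "(\<forall>x. x \<noteq> i \<and> x \<noteq> l \<longrightarrow> P x) \<longleftrightarrow> P j \<and> P k" for P
      using other d by blast+
    note all = this
    show ?thesis
      using that(1,2) that(3,4)[of j] that(3,4)[of k] that(3,4)[of l] d(7-9) unfolding all by blast
  qed
  then show ?thesis
  proof cases
    case 1
    obtain j' k' l' where V: "{i, j', k', l'} = UNIV" "\<forall>t s r. even t \<and> even s \<and> even r \<longrightarrow>
        tabulated i (e_pattern i j' k' l' t s r) (f_pattern i j' k' l' t s r)"
      using tabulated_all_even[of i] by (elim exE conjE) (rule that)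
    show ?thesis
      by (rule by_arrangement[OF V(1) V(2)[rule_format]]) (simp add: 1 indices_distinct[OF V(1)] del: insert_iff)
  next
    case 2
    obtain j' k' l' where V: "{i, j', k', l'} = UNIV" "\<forall>t s r. odd t \<and> odd s \<and> odd r \<longrightarrow>
        tabulated i (e_pattern i j' k' l' t s r) (f_pattern i j' k' l' t s r)"
      using tabulated_all_odd[of i] by (elim exE conjE) (rule that)
    show ?thesis
      by (rule by_arrangement[OF V(1) V(2)[rule_format]]) (simp add: 2 indices_distinct[OF V(1)] del: insert_iff)
  next
    case 3
    obtain x y where "{i, x, y, m} = UNIV" using others[OF 3(1)] by blast
    from tabulated_one_odd[OF this]
    obtain j' k' where V: "{i, j', k', m} = UNIV" "\<forall>t s r. odd t \<and> even s \<and> even r \<longrightarrow>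
        tabulated i (e_pattern i j' k' m t s r) (f_pattern i j' k' m t s r)"
      by (elim exE conjE) (rule that)
    show ?thesis
      by (rule by_arrangement[OF V(1) V(2)[rule_format]]) (simp add: 3 indices_distinct[OF V(1)] del: insert_iff)
  next
    case 4
    obtain x y where "{i, x, y, m} = UNIV" using others[OF 4(1)] by blast
    from tabulated_two_odd[OF this]
    obtain j' l' where V: "{i, j', m, l'} = UNIV" "\<forall>t s r. odd t \<and> odd s \<and> even r \<longrightarrow>
        tabulated i (e_pattern i j' m l' t s r) (f_pattern i j' m l' t s r)"
      by (elim exE conjE) (rule that)
    show ?thesis
      by (rule by_arrangement[OF V(1) V(2)[rule_format]]) (simp add: 4 indices_distinct[OF V(1)] del: insert_iff)
  qed
qed

text \<open>
  Sequences ending at \<open>i\<close> realize the pairs $(e_\<alpha>, f_{\<alpha>0})$ jointly, so that both parts of the theorem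
  are projections of this description. Identified sequences have the same end, which is why it is read
  off from the normal form.
\<close>

lemma tabulated_iff:
  assumes U: "{i, j, k, l} = (UNIV :: idx set)"
  shows "tabulated i x y \<longleftrightarrow> (\<exists>t s r. x = e_pattern i j k l t s r \<and> y = f_pattern i j k l t s r)"
proof
  assume "tabulated i x y"
  then obtain m \<beta> where "hd \<beta> = i" "row_at m \<beta> x y"
    unfolding tabulated_def using same_seq_hd by metis
  moreover obtain p2 p3 p4 where "{m, p2, p3, p4} = UNIV" "row_at m = row m p2 p3 p4"
    by (rule row_at_obtain)
  ultimately obtain j' k' l' t s r where V: "{i, j', k', l'} = UNIV"
    and xy: "x = e_pattern i j' k' l' t s r" "y = f_pattern i j' k' l' t s r"
    using row_values by metis
  define n where "n = (\<lambda>_. 0)(l' := t, j' := s, k' := r)"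
  have "n l' = t" "n j' = s" "n k' = r"
    using indices_distinct[OF V] by (simp_all add: n_def)
  then show "\<exists>t s r. x = e_pattern i j k l t s r \<and> y = f_pattern i j k l t s r"
    using patterns_arrangement[OF U V, of n] xy by metis
next
  assume "\<exists>t s r. x = e_pattern i j k l t s r \<and> y = f_pattern i j k l t s r"
  then obtain t s r where xy: "x = e_pattern i j k l t s r" "y = f_pattern i j k l t s r" by blast
  define n where "n = (\<lambda>_. 0)(l := t, j := s, k := r)"
  have "n l = t" "n j = s" "n k = r"
    using indices_distinct[OF U] by (simp_all add: n_def)
  then show "tabulated i x y" using tabulated_pattern[OF U, of n] xy by simp
qed

lemma is_e_ending_iff: "(\<exists>\<alpha>. hd \<alpha> = i \<and> is_e \<alpha> x) \<longleftrightarrow> (\<exists>y. tabulated i x y)"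
  unfolding is_e_def tabulated_def by blast

lemma is_f0_ending_iff: "(\<exists>\<alpha>. hd \<alpha> = i \<and> is_f0 \<alpha> y) \<longleftrightarrow> (\<exists>x. tabulated i x y)"
  unfolding is_f0_def tabulated_def by blast

lemma e_pattern_meets:
  assumes "{i, j, k, l} = (UNIV :: idx set)"
  shows "e i \<sqinter> a j k t \<sqinter> a k l s \<sqinter> a l j r = e_pattern i j k l t s r"
    "e i \<sqinter> a j k t \<sqinter> a k l s \<sqinter> a j l r = e_pattern i j k l t s r"
    "e i \<sqinter> a j l r \<sqinter> a l k s \<sqinter> a k j t = e_pattern i j k l t s r"
  unfolding meet_traces e_pattern_def using indices_distinct[OF assms]
  by (simp_all add: trace_commute[of i k j] trace_commute[of i l j] trace_commute[of i l k] inf_aci)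

theorem proposition3p1:
  shows "({x. \<exists>\<alpha>. hd \<alpha> = n1 \<and> is_e \<alpha> x} =
       {e n1 \<sqinter> a n3 n2 r \<sqinter> a n2 n4 s \<sqinter> a n3 n4 t | r s t. True}) \<and>
    (\<forall>i j k l. i \<noteq> n1 \<and> {i, j, k, l} = UNIV \<longrightarrow>
       {x. \<exists>\<alpha>. hd \<alpha> = i \<and> is_e \<alpha> x} =
       {e i \<sqinter> a j l r \<sqinter> a l k s \<sqinter> a k j t | r s t. True}) \<and>
    ({y. \<exists>\<alpha>. hd \<alpha> = n1 \<and> is_f0 \<alpha> y} =
       {e n1 \<sqinter> a n3 n4 t \<sqinter> a n4 n2 s \<sqinter> a n3 n2 r \<sqinter> factor n1 n3 n4 n2 t s r | r s t. True}) \<and>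
    (\<forall>i j k l. i \<noteq> n1 \<and> {i, j, k, l} = UNIV \<longrightarrow>
       {y. \<exists>\<alpha>. hd \<alpha> = i \<and> is_f0 \<alpha> y} =
       {e i \<sqinter> a j k t \<sqinter> a k l s \<sqinter> a l j r \<sqinter> factor i j k l t s r | r s t. True})"
proof -
  have E: "{x. \<exists>\<alpha>. hd \<alpha> = i \<and> is_e \<alpha> x} = {e_pattern i j k l t s r | r s t. True}"
    and F: "{y. \<exists>\<alpha>. hd \<alpha> = i \<and> is_f0 \<alpha> y} = {e_pattern i j k l t s r \<sqinter> factor i j k l t s r | r s t. True}"
    if "{i, j, k, l} = UNIV" for i j k l
    unfolding is_e_ending_iff is_f0_ending_iff tabulated_iff[OF that] f_pattern_factor[OF that] by blast+
  have U1: "{n1, n3, n2, n4} = UNIV" "{n1, n3, n4, n2} = UNIV" unfolding UNIV_idx by auto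
  have "e n1 \<sqinter> a n3 n2 r \<sqinter> a n2 n4 s \<sqinter> a n3 n4 t = e_pattern n1 n3 n2 n4 r s t" for r s t
    by (rule e_pattern_meets(2)[OF U1(1)])
  then have 1: "{x. \<exists>\<alpha>. hd \<alpha> = n1 \<and> is_e \<alpha> x} =
       {e n1 \<sqinter> a n3 n2 r \<sqinter> a n2 n4 s \<sqinter> a n3 n4 t | r s t. True}"
    unfolding E[OF U1(1)] by (simp) blast
  have 2: "{y. \<exists>\<alpha>. hd \<alpha> = n1 \<and> is_f0 \<alpha> y} =
       {e n1 \<sqinter> a n3 n4 t \<sqinter> a n4 n2 s \<sqinter> a n3 n2 r \<sqinter> factor n1 n3 n4 n2 t s r | r s t. True}"
    unfolding F[OF U1(2)] e_pattern_meets(2)[OF U1(2)] ..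
  show ?thesis
    using 1 2 E F by (simp add: e_pattern_meets(1,3))
qed

end
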